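(* Let $f\in L^2(\mathbb{R}^{p,q},Cl(p,q))$ and put $F=\int_{\mathbb{R}^{p,q}}|f(x)|^2\,d^nx$. Then $$\int_{\mathbb{R}^{p,q}}|x|^2|f(x)|^2\,d^nx\;\cdot\;\frac{1}{(2\pi)^n}\int_{\mathbb{R}^{p,q}}|w|^2\,|\mathcal{F}^i\{f\}(w)|^2\,d^nw\;\geq\; n\,\frac14\,F^2 .$$
   Context: Let $n=p+q\ge 1$. $Cl(p,q)$ is the real associative unital Clifford algebra generated by $e_1,\dots,e_n$ with $e_ke_l+e_le_k=2\epsilon_k\delta_{k,l}$, where $\epsilon_k=+1$ for $1\le k\le p$ and $\epsilon_k=-1$ for $p+1\le k\le n$. It has the basis $e_A=e_{i_1}\cdots e_{i_k}$, $A=\{i_1<\cdots<i_k\}\subseteq\{1,\dots,n\}$, $e_\emptyset=1$; elements are written $M=\sum_A M_Ae_A$ with $M_A\in\mathbb{R}$, and $\langle M\rangle_k$ denotes the grade-$k$ part. The scalar product is $M\ast N=\langle MN\rangle_0$. The principal reverse is $\widetilde{M}=\sum_{k=0}^n(-1)^{k(k-1)/2}\,\overline{\langle M\rangle_k}$, where the bar is linear with $\overline{e_{i_1}\cdots e_{i_k}}=\epsilon_{i_1}e_{i_1}\cdots\epsilon_{i_k}e_{i_k}$; one has $M\ast\widetilde N=\sum_AM_AN_A$, and the modulus is $|M|^2=M\ast\widetilde M=\sum_AM_A^2$. Vectors $x\in\mathbb{R}^{p,q}$ are identified with $x=\sum_{l}x_le^l=\sum_l x^le_l$, where $e^l=\epsilon_le_l$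 (so $x^l=\epsilon_lx_l$), and $|x|^2=\sum_l x_l^2$. $d^nx=dx_1\cdots dx_n$ is Lebesgue measure. $L^2(\mathbb{R}^{p,q},Cl(p,q))$ is the space of (measurable) $f=\sum_Af_Ae_A:\mathbb{R}^{p,q}\to Cl(p,q)$, $f_A$ real-valued, with $\int|f(x)|^2d^nx<\infty$. Fix $i\in Cl(p,q)$ with $i^2=-1$ and $\widetilde i=-i$. For $f\in L^1(\mathbb{R}^{p,q},Cl(p,q))$ the Clifford Fourier transform with respect to $i$ is $$\mathcal{F}^i\{f\}(w)=\int_{\mathbb{R}^{p,q}}f(x)e^{-iu(x,w)}\,d^nx,\qquad u(x,w)=x\ast\widetilde w=\sum_{l=1}^nx_lw_l,$$ where $e^{-i\theta}=\cos\theta-i\sin\theta$ for $\theta\in\mathbb{R}$; it is extended to $L^2$ by continuity in the usual Plancherel sense. Integrals of nonnegative functions take values in $[0,\infty]$, with $0\cdot\infty=0$. *)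

theory Defs
  imports "HOL-Analysis.Analysis"
begin

text \<open>
  A multivector \<open>M = (\<Sum>A. M\<^sub>A e\<^sub>A)\<close> is stored as its family of coefficients, indexed by
  the subsets \<open>A\<close> of the index type \<open>'n\<close>.  The elements of \<open>'n\<close>, listed in increasing
  order, play the role of \<open>1, \<dots>, n\<close> with \<open>n = CARD('n)\<close>.  The signature is determined by
  \<open>p\<close> (with \<open>q = n - p\<close>), so \<open>p\<close> is a parameter of the product.  The pointwise product
  which the library provides on \<open>vec\<close> is not the Clifford product and is not used.
  The modulus \<open>\<bar>M\<bar>\<close> is the library's \<open>norm\<close>; see \<open>modulus_eq_norm\<close> below.
\<close>

type_synonym 'n coords = "(real, 'n) vec"
type_synonym 'n multivector = "real ^ ('n set)"

definition eps :: "nat \<Rightarrow> 'n::{finite,linorder} \<Rightarrow> real" where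
  "eps p k = (if card {j. j \<le> k} \<le> p then 1 else - 1)"

definition blade :: "'n::{finite,linorder} set \<Rightarrow> 'n multivector" where
  "blade A = axis A 1"

abbreviation gen :: "'n::{finite,linorder} \<Rightarrow> 'n multivector" where
  "gen k \<equiv> blade {k}"

text \<open>
  \<open>e\<^sub>A e\<^sub>B = blade_sign p A B \<sqdot> e\<^sub>C\<close> with \<open>C\<close> the symmetric difference: sorting the
  concatenated word contributes \<open>-1\<close> for each pair \<open>a \<in> A\<close>, \<open>b \<in> B\<close> with \<open>b < a\<close>, and
  every common index \<open>a\<close> contributes \<open>e\<^sub>a\<^sup>2 = \<epsilon>\<^sub>a\<close>.
\<close>

definition blade_sign :: "nat \<Rightarrow> 'n::{finite,linorder} set \<Rightarrow> 'n set \<Rightarrow> real" where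
  "blade_sign p A B =
     (\<Prod>a\<in>A. \<Prod>b\<in>B. if b < a then - 1 else if b = a then eps p a else 1)"

definition gprod :: "nat \<Rightarrow> 'n::{finite,linorder} multivector \<Rightarrow> 'n multivector \<Rightarrow> 'n multivector" where
  "gprod p M N =
     (\<Sum>A\<in>UNIV. \<Sum>B\<in>UNIV. (M $ A * N $ B * blade_sign p A B) *\<^sub>R blade (sym_diff A B))"

definition grade_part :: "nat \<Rightarrow> 'n::{finite,linorder} multivector \<Rightarrow> 'n multivector" where
  "grade_part k M = (\<Sum>A | card A = k. (M $ A) *\<^sub>R blade A)"

definition scalar_prod :: "nat \<Rightarrow> 'n::{finite,linorder} multivector \<Rightarrow> 'n multivector \<Rightarrow> real" where
  "scalar_prod p M N = gprod p M N $ {}"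

definition sign_bar :: "nat \<Rightarrow> 'n::{finite,linorder} multivector \<Rightarrow> 'n multivector" where
  "sign_bar p M = (\<Sum>A\<in>UNIV. (M $ A * (\<Prod>a\<in>A. eps p a)) *\<^sub>R blade A)"

definition principal_reverse :: "nat \<Rightarrow> 'n::{finite,linorder} multivector \<Rightarrow> 'n multivector" where
  "principal_reverse p M =
     (\<Sum>k=0..CARD('n). (- 1) ^ (k * (k - 1) div 2) *\<^sub>R sign_bar p (grade_part k M))"

text \<open>
  A point of \<open>\<real>\<^sup>p\<^sup>,\<^sup>q\<close> is the tuple of its coordinates \<open>x\<^sub>l\<close> with respect to the
  reciprocal basis \<open>e\<^sup>l = \<epsilon>\<^sub>l e\<^sub>l\<close>.
\<close>

definition vec_embed :: "nat \<Rightarrow> 'n::{finite,linorder} coords \<Rightarrow> 'n multivector" where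
  "vec_embed p x = (\<Sum>l\<in>UNIV. (x $ l) *\<^sub>R (eps p l *\<^sub>R gen l))"

definition phase :: "nat \<Rightarrow> 'n::{finite,linorder} coords \<Rightarrow> 'n coords \<Rightarrow> real" where
  "phase p x w = scalar_prod p (vec_embed p x) (principal_reverse p (vec_embed p w))"

definition exp_neg :: "'n::{finite,linorder} multivector \<Rightarrow> real \<Rightarrow> 'n multivector" where
  "exp_neg i \<theta> = cos \<theta> *\<^sub>R blade {} - sin \<theta> *\<^sub>R i"

definition L1_space :: "('n::{finite,linorder} coords \<Rightarrow> 'n multivector) set" where
  "L1_space = {f. integrable lebesgue f}"

definition L2_space :: "('n::{finite,linorder} coords \<Rightarrow> 'n multivector) set" where
  "L2_space = {f. f \<in> borel_measurable lebesgue \<and> integrable lebesgue (\<lambda>x. (norm (f x))\<^sup>2)}"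

definition L2_tendsto ::
  "(nat \<Rightarrow> 'n::{finite,linorder} coords \<Rightarrow> 'n multivector) \<Rightarrow> ('n coords \<Rightarrow> 'n multivector) \<Rightarrow> bool" where
  "L2_tendsto h f \<longleftrightarrow>
     (\<lambda>k. \<integral>\<^sup>+x. ennreal ((norm (h k x - f x))\<^sup>2) \<partial>lebesgue) \<longlonglongrightarrow> 0"

definition CFT_L1 ::
  "nat \<Rightarrow> 'n::{finite,linorder} multivector \<Rightarrow> ('n coords \<Rightarrow> 'n multivector) \<Rightarrow> 'n coords \<Rightarrow> 'n multivector" where
  "CFT_L1 p i f w = (\<integral>x. gprod p (f x) (exp_neg i (phase p x w)) \<partial>lebesgue)"

text \<open>
  The extension by continuity from \<open>L\<^sup>1 \<inter> L\<^sup>2\<close> to \<open>L\<^sup>2\<close>.  Truncations of \<open>f\<close> provide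
  approximating sequences, so the transform is determined up to a null set; \<open>SOME\<close> picks a
  representative.
\<close>

definition is_CFT_L2 ::
  "nat \<Rightarrow> 'n::{finite,linorder} multivector \<Rightarrow> ('n coords \<Rightarrow> 'n multivector) \<Rightarrow>
   ('n coords \<Rightarrow> 'n multivector) \<Rightarrow> bool" where
  "is_CFT_L2 p i f g \<longleftrightarrow> g \<in> L2_space \<and>
     (\<forall>h. (\<forall>k. h k \<in> L1_space \<inter> L2_space) \<and> L2_tendsto h f \<longrightarrow>
          L2_tendsto (\<lambda>k. CFT_L1 p i (h k)) g)"

definition CFT ::
  "nat \<Rightarrow> 'n::{finite,linorder} multivector \<Rightarrow> ('n coords \<Rightarrow> 'n multivector) \<Rightarrow> 'n coords \<Rightarrow> 'n multivector" where
  "CFT p i f = (SOME g. is_CFT_L2 p i f g)"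


section \<open>The product is that of the Clifford algebra\<close>

lemma eps_square [simp]: "eps p k * eps p k = 1"
  by (simp add: eps_def)

lemma prod_sym_diff:
  fixes g :: "'a::finite \<Rightarrow> real"
  assumes "\<And>x. g x * g x = 1"
  shows "prod g (sym_diff A B) = prod g A * prod g B"
proof -
  have A: "prod g A = prod g (A - B) * prod g (A \<inter> B)"
    by (subst prod.union_disjoint [symmetric]) (auto intro: arg_cong [of _ _ "prod g"])
  have B: "prod g B = prod g (B - A) * prod g (A \<inter> B)"
    by (subst prod.union_disjoint [symmetric]) (auto intro: arg_cong [of _ _ "prod g"])
  have I: "prod g (A \<inter> B) * prod g (A \<inter> B) = 1"
    by (simp add: prod.distrib [symmetric] assms)
  have "prod g (sym_diff A B) = prod g (A - B) * prod g (B - A)"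
    by (rule prod.union_disjoint) auto
  also have "\<dots> = prod g (A - B) * prod g (B - A) * (prod g (A \<inter> B) * prod g (A \<inter> B))"
    by (simp add: I)
  finally show ?thesis by (simp add: A B)
qed

lemma blade_sign_left: "blade_sign p (sym_diff A B) C = blade_sign p A C * blade_sign p B C"
  unfolding blade_sign_def
  by (rule prod_sym_diff) (auto simp: prod.distrib [symmetric] intro!: prod.neutral)

lemma blade_sign_right: "blade_sign p C (sym_diff A B) = blade_sign p C A * blade_sign p C B"
  unfolding blade_sign_def
  by (subst prod.distrib [symmetric], rule prod.cong [OF refl], rule prod_sym_diff) simp

lemma blade_nth: "blade A $ B = (if B = A then 1 else 0)"
  by (simp add: blade_def axis_def)

lemma multivector_expansion:
  fixes M :: "'n::{finite,linorder} multivector"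
  shows "M = (\<Sum>A\<in>UNIV. (M $ A) *\<^sub>R blade A)"
  by (simp add: vec_eq_iff blade_nth if_distrib cong: if_cong)

lemma bilinear_gprod: "bilinear (gprod p)"
  unfolding bilinear_def
  by (auto intro!: linearI simp: gprod_def algebra_simps sum.distrib scaleR_sum_right)

lemma gprod_blade:
  "gprod p (blade A) (blade B) = blade_sign p A B *\<^sub>R blade (sym_diff A B)"
proof -
  have "gprod p (blade A) (blade B) =
      (\<Sum>A'\<in>UNIV. \<Sum>B'\<in>UNIV. if B' = B then (if A' = A then
         blade_sign p A B *\<^sub>R blade (sym_diff A B) else 0) else 0)"
    unfolding gprod_def by (intro sum.cong refl) (simp add: blade_nth)
  then show ?thesis by simp
qed

lemma gprod_sum_left:
  "gprod p (\<Sum>a\<in>S. f a) N = (\<Sum>a\<in>S. gprod p (f a) N)"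
  by (rule linear_sum [OF bilinear_gprod [unfolded bilinear_def, THEN conjunct2, THEN spec]])

lemma gprod_sum_right:
  "gprod p M (\<Sum>a\<in>S. f a) = (\<Sum>a\<in>S. gprod p M (f a))"
  by (rule linear_sum [OF bilinear_gprod [unfolded bilinear_def, THEN conjunct1, THEN spec]])

lemma gprod_scaleR:
  "gprod p (c *\<^sub>R M) N = c *\<^sub>R gprod p M N"
  "gprod p M (c *\<^sub>R N) = c *\<^sub>R gprod p M N"
  by (rule bilinear_lmul [OF bilinear_gprod], rule bilinear_rmul [OF bilinear_gprod])

lemma gprod_assoc_blade:
  "gprod p (gprod p (blade A) (blade B)) (blade C) = gprod p (blade A) (gprod p (blade B) (blade C))"
proof -
  have "sym_diff (sym_diff A B) C = sym_diff A (sym_diff B C)" by blast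
  then show ?thesis
    unfolding gprod_blade gprod_scaleR blade_sign_left blade_sign_right by simp
qed

theorem gprod_assoc: "gprod p (gprod p L M) N = gprod p L (gprod p M N)"
  by (subst (1 2) multivector_expansion [of L], subst (1 2) multivector_expansion [of M],
      subst (1 2) multivector_expansion [of N])
     (simp only: gprod_sum_left gprod_sum_right gprod_scaleR gprod_assoc_blade scaleR_scaleR
        scaleR_sum_right mult.assoc)

theorem gprod_one: "gprod p (blade {}) M = M" "gprod p M (blade {}) = M"
proof -
  show "gprod p (blade {}) M = M"
    by (subst (1 2) multivector_expansion [of M])
       (simp add: gprod_sum_right gprod_scaleR gprod_blade blade_sign_def)
  show "gprod p M (blade {}) = M"
    by (subst (1 2) multivector_expansion [of M])
       (simp add: gprod_sum_left gprod_scaleR gprod_blade blade_sign_def)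
qed

theorem gprod_gen:
  "gprod p (gen k) (gen l) + gprod p (gen l) (gen k) = (if k = l then (2 * eps p k) *\<^sub>R blade {} else 0)"
proof (cases "k = l")
  case True
  then show ?thesis
    by (simp add: gprod_blade blade_sign_def scaleR_add_left [symmetric])
next
  case False
  then have "sym_diff {k} {l} = sym_diff {l} {k}" by blast
  then show ?thesis using False
    by (auto simp: gprod_blade blade_sign_def)
qed

theorem blade_eq_product:
  "blade A = foldr (\<lambda>k M. gprod p (gen k) M) (sorted_list_of_set A) (blade {})"
proof -
  have "foldr (\<lambda>k M. gprod p (gen k) M) ks (blade {}) = blade (set ks)"
    if "sorted_wrt (<) ks" for ks :: "'a list"
    using that
  proof (induction ks)
    case (Cons k ks)
    then have less: "\<forall>x\<in>set ks. k < x" by simp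
    then have "blade_sign p {k} (set ks) = 1"
      by (fastforce simp: blade_sign_def intro!: prod.neutral)
    moreover have "k \<notin> set ks" using less by blast
    then have "sym_diff {k} (set ks) = insert k (set ks)" by blast
    ultimately show ?case using Cons by (simp add: gprod_blade)
  qed simp
  from this [of "sorted_list_of_set A"] show ?thesis by simp
qed


section \<open>Modulus and phase\<close>

lemma principal_reverse_nth:
  fixes M :: "'n::{finite,linorder} multivector"
  shows "principal_reverse p M $ A =
    (- 1) ^ (card A * (card A - 1) div 2) * (\<Prod>a\<in>A. eps p a) * M $ A"
proof -
  have g: "grade_part k M $ A = (if card A = k then M $ A else 0)" for k
    by (simp add: grade_part_def blade_nth if_distrib cong: if_cong)
  have b: "sign_bar p N $ A = N $ A * (\<Prod>a\<in>A. eps p a)" for N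
    by (simp add: sign_bar_def blade_nth if_distrib cong: if_cong)
  have "card A \<le> CARD('n)" by (simp add: card_mono)
  then show ?thesis
    by (simp add: principal_reverse_def b g if_distrib if_distribR mult_ac cong: if_cong)
qed

lemma blade_sign_self:
  "blade_sign p A A = (- 1) ^ (card A * (card A - 1) div 2) * (\<Prod>a\<in>A. eps p a)"
  using finite [of A]
proof (induction A rule: finite_linorder_max_induct)
  case empty
  then show ?case by (simp add: blade_sign_def)
next
  case (insert m A)
  then have nm: "m \<notin> A" by blast
  then have eq: "insert m A = sym_diff {m} A" by blast
  have "blade_sign p {m} A = (\<Prod>b\<in>A. - 1)"
    using insert by (auto simp: blade_sign_def intro!: prod.cong)
  moreover have "blade_sign p A {m} = 1"
    using insert by (fastforce simp: blade_sign_def intro!: prod.neutral)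
  moreover have "blade_sign p {m} {m} = eps p m" by (simp add: blade_sign_def)
  ultimately have "blade_sign p (insert m A) (insert m A) =
      eps p m * (- 1) ^ card A * blade_sign p A A"
    unfolding eq blade_sign_left blade_sign_right by simp
  moreover have "card (insert m A) * (card (insert m A) - 1) div 2 =
      card A + card A * (card A - 1) div 2"
  proof -
    have "Suc c * c = c * 2 + c * (c - 1)" for c :: nat by (cases c) auto
    then have "Suc c * c div 2 = c + c * (c - 1) div 2" for c :: nat by simp
    then show ?thesis using nm by simp
  qed
  ultimately show ?case using insert nm by (simp add: power_add)
qed

theorem scalar_prod_principal_reverse: "scalar_prod p M (principal_reverse p N) = M \<bullet> N"
proof -
  have sq: "blade_sign p A A * blade_sign p A A = 1" for A :: "'a set"
    unfolding blade_sign_def by (auto simp: prod.distrib [symmetric] intro!: prod.neutral)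
  have "scalar_prod p M (principal_reverse p N) =
      (\<Sum>A\<in>UNIV. \<Sum>B\<in>UNIV. if B = A then M $ A * N $ A else 0)"
    unfolding scalar_prod_def gprod_def
  proof (simp only: sum_component, intro sum.cong refl)
    fix A B :: "'a set"
    have "sym_diff A B = {} \<longleftrightarrow> B = A" by blast
    moreover have "principal_reverse p N $ A = blade_sign p A A * N $ A"
      by (simp add: principal_reverse_nth blade_sign_self)
    ultimately show "((M $ A * principal_reverse p N $ B * blade_sign p A B) *\<^sub>R
        blade (sym_diff A B)) $ {} = (if B = A then M $ A * N $ A else 0)"
      using sq [of A] by (auto simp: blade_nth)
  qed
  then show ?thesis by (simp add: inner_vec_def)
qed

theorem modulus_eq_norm: "scalar_prod p M (principal_reverse p M) = (norm M)\<^sup>2"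
  by (simp add: scalar_prod_principal_reverse power2_norm_eq_inner)

theorem phase_eq_inner: "phase p x w = x \<bullet> w"
proof -
  have "gen k \<bullet> gen l = (if k = l then 1 else 0)" for k l :: 'a
    by (simp add: blade_def inner_axis_axis)
  then have "vec_embed p x \<bullet> vec_embed p w =
      (\<Sum>l\<in>UNIV. \<Sum>k\<in>UNIV. if k = l then x $ l * w $ l * (eps p l * eps p l) else 0)"
    unfolding vec_embed_def inner_sum_left inner_sum_right
    by (intro sum.cong refl) auto
  then show ?thesis
    by (simp add: phase_def scalar_prod_principal_reverse inner_vec_def)
qed

end

theory Submission
  imports Defs "HOL-Probability.Probability"
begin

text \<open>
  Right multiplication by \<open>i\<close> is a linear map \<open>J\<close> on multivectors with \<open>J \<circ> J = -1\<close>, because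
  \<open>i\<^sup>2 = -1\<close>.  It is skew for the inner product \<open>M \<ast> rev N = \<Sum>\<^sub>A M\<^sub>A N\<^sub>A\<close>, because the principal
  reverse is an anti-automorphism that negates \<open>i\<close>.  The Clifford Fourier transform is therefore
  the Fourier transform of functions with values in a Euclidean space that carries an orthogonal
  complex structure \<open>J\<close>, and the analysis is done in that generality, in the locale
  \<open>orthogonal_complex_structure\<close>.  Below, \<open>n\<close> is the dimension of the domain and \<open>\<parallel>\<cdot>\<parallel>\<close> the norm
  of \<open>L\<^sup>2\<close>.

  Plancherel's identity \<open>\<parallel>F f\<parallel>\<^sup>2 = (2\<pi>)\<^sup>n \<parallel>f\<parallel>\<^sup>2\<close> on \<open>L\<^sup>1 \<inter> L\<^sup>2\<close> comes from damping \<open>\<bar>F f(w)\<bar>\<^sup>2\<close> by the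
  Gaussian \<open>exp (-\<epsilon>\<^sup>2\<bar>w\<bar>\<^sup>2/2)\<close>.  By Fubini's theorem the damped integral equals \<open>\<integral> \<kappa>(u) R(\<epsilon>u) du\<close>,
  where \<open>R(z) = \<integral> f(x) \<cdot> f(x+z) dx\<close> is the autocorrelation of \<open>f\<close> and \<open>\<kappa>\<close> is a Gaussian of total
  mass \<open>(2\<pi>)\<^sup>n\<close> (\<open>gaussian_regularised_energy\<close>).  Since \<open>R\<close> is continuous at \<open>0\<close> with
  \<open>R(0) = \<parallel>f\<parallel>\<^sup>2\<close> (\<open>autocorrelation_tendsto\<close>), letting \<open>\<epsilon> \<rightarrow> 0\<close> gives the identity.  Completeness of
  \<open>L\<^sup>2\<close> (\<open>l2_complete\<close>) then provides the continuous extension to \<open>L\<^sup>2\<close>.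

  The uncertainty inequality is obtained from finite differences instead of derivatives.  Let \<open>g\<close>
  be the transform of \<open>f\<close>, let \<open>e\<close> be a unit vector, \<open>t > 0\<close>, and \<open>d(x) = f(x+te) - f(x)\<close>.  On the
  Fourier side a translation is a rotation by the angle \<open>t e\<cdot>w\<close>, so
  \<open>(2\<pi>)\<^bsup>n/2\<^esup> \<parallel>d\<parallel> \<le> t \<parallel>(e\<cdot>w) g\<parallel>\<close> (\<open>shift_difference_le\<close>).  On the other hand the translation moves
  the first moment of \<open>\<bar>f\<bar>\<^sup>2\<close> in the direction \<open>e\<close> by \<open>-t \<parallel>f\<parallel>\<^sup>2\<close>, and that change of moment is the
  integral of \<open>d(x) \<cdot> (e\<cdot>x) (f(x+te) + f(x))\<close>.  The Cauchy--Schwarz inequality, division by \<open>t\<close> and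
  \<open>t \<rightarrow> 0\<close> yield \<open>(2\<pi>)\<^bsup>n/2\<^esup> \<parallel>f\<parallel>\<^sup>2 \<le> 2 \<parallel>(e\<cdot>x) f\<parallel> \<parallel>(e\<cdot>w) g\<parallel>\<close> (\<open>directional_uncertainty\<close>).  Squaring and
  summing over an orthonormal basis gives the factor \<open>n\<close>.
\<close>

section \<open>Square integrable functions\<close>

definition sq_integrable :: "'x measure \<Rightarrow> ('x \<Rightarrow> 'v::euclidean_space) \<Rightarrow> bool" where
  "sq_integrable M f \<longleftrightarrow> f \<in> borel_measurable M \<and> integrable M (\<lambda>x. (norm (f x))\<^sup>2)"

definition l2norm :: "'x measure \<Rightarrow> ('x \<Rightarrow> 'v::euclidean_space) \<Rightarrow> real" where
  "l2norm M f = sqrt (\<integral>x. (norm (f x))\<^sup>2 \<partial>M)"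

lemma l2norm_nonneg [simp]: "0 \<le> l2norm M f"
  by (simp add: l2norm_def)

lemma l2norm_power2: "(l2norm M f)\<^sup>2 = (\<integral>x. (norm (f x))\<^sup>2 \<partial>M)"
  by (simp add: l2norm_def)

lemma sq_integrable_bound:
  fixes f :: "'x \<Rightarrow> 'v::euclidean_space" and g :: "'x \<Rightarrow> 'w::euclidean_space"
  assumes "sq_integrable M g" "f \<in> borel_measurable M" "\<And>x. norm (f x) \<le> c * norm (g x)"
  shows "sq_integrable M f"
proof -
  have "norm ((norm (f x))\<^sup>2) \<le> norm (c\<^sup>2 * (norm (g x))\<^sup>2)" for x
    using power_mono[OF assms(3)[of x], of 2] by (simp add: power_mult_distrib)
  moreover have "integrable M (\<lambda>x. c\<^sup>2 * (norm (g x))\<^sup>2)" "(\<lambda>x. (norm (f x))\<^sup>2) \<in> borel_measurable M"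
    using assms by (auto simp: sq_integrable_def)
  ultimately show ?thesis
    using assms(2) Bochner_Integration.integrable_bound unfolding sq_integrable_def by blast
qed

lemma sq_integrable_scale: "sq_integrable M f \<Longrightarrow> sq_integrable M (\<lambda>x. c *\<^sub>R f x)"
  by (rule sq_integrable_bound[where g = f and c = "\<bar>c\<bar>"]) (auto simp: sq_integrable_def)

lemma sq_integrable_add:
  assumes "sq_integrable M f" "sq_integrable M g"
  shows "sq_integrable M (\<lambda>x. f x + g x)"
proof -
  have "norm ((norm (f x + g x))\<^sup>2) \<le> norm (2 * (norm (f x))\<^sup>2 + 2 * (norm (g x))\<^sup>2)" for x
  proof -
    have "(norm (f x + g x))\<^sup>2 \<le> (norm (f x) + norm (g x))\<^sup>2"
      by (intro power_mono norm_triangle_ineq) auto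
    also have "\<dots> \<le> 2 * (norm (f x))\<^sup>2 + 2 * (norm (g x))\<^sup>2"
      using sum_squares_bound[of "norm (f x)" "norm (g x)"] by (simp add: power2_sum)
    finally show ?thesis by simp
  qed
  moreover have "integrable M (\<lambda>x. 2 * (norm (f x))\<^sup>2 + 2 * (norm (g x))\<^sup>2)"
    "(\<lambda>x. (norm (f x + g x))\<^sup>2) \<in> borel_measurable M" "(\<lambda>x. f x + g x) \<in> borel_measurable M"
    using assms by (auto simp: sq_integrable_def)
  ultimately show ?thesis
    using Bochner_Integration.integrable_bound unfolding sq_integrable_def by blast
qed

lemma sq_integrable_diff:
  assumes "sq_integrable M f" "sq_integrable M g"
  shows "sq_integrable M (\<lambda>x. f x - g x)"
  using sq_integrable_add[OF assms(1) sq_integrable_scale[OF assms(2), of "-1"]] by simp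

lemma integrable_norm_mult:
  assumes "sq_integrable M f" "sq_integrable M g"
  shows "integrable M (\<lambda>x. norm (f x) * norm (g x))"
proof -
  have "norm (norm (f x) * norm (g x)) \<le> norm ((norm (f x))\<^sup>2 + (norm (g x))\<^sup>2)" for x
  proof -
    have "0 \<le> norm (f x) * norm (g x)" by simp
    then have "norm (f x) * norm (g x) \<le> (norm (f x))\<^sup>2 + (norm (g x))\<^sup>2"
      using sum_squares_bound[of "norm (f x)" "norm (g x)", unfolded mult.assoc] by linarith
    then show ?thesis by simp
  qed
  moreover have "integrable M (\<lambda>x. (norm (f x))\<^sup>2 + (norm (g x))\<^sup>2)"
    "(\<lambda>x. norm (f x) * norm (g x)) \<in> borel_measurable M"
    using assms by (auto simp: sq_integrable_def)
  ultimately show ?thesis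
    using Bochner_Integration.integrable_bound by blast
qed

lemma integrable_inner:
  assumes "sq_integrable M f" "sq_integrable M g"
  shows "integrable M (\<lambda>x. f x \<bullet> g x)"
  by (rule Bochner_Integration.integrable_bound[OF integrable_norm_mult[OF assms]])
     (use assms in \<open>auto simp: sq_integrable_def Cauchy_Schwarz_ineq2\<close>)

lemma nn_integral_norm_power2:
  assumes "sq_integrable M f"
  shows "(\<integral>\<^sup>+x. ennreal ((norm (f x))\<^sup>2) \<partial>M) = ennreal ((l2norm M f)\<^sup>2)"
  using assms unfolding l2norm_power2 sq_integrable_def by (auto intro: nn_integral_eq_integral)

lemma Cauchy_Schwarz_l2norm:
  assumes "sq_integrable M f" "sq_integrable M g"
  shows "(\<integral>x. norm (f x) * norm (g x) \<partial>M) \<le> l2norm M f * l2norm M g"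
proof -
  have [measurable]: "f \<in> borel_measurable M" "g \<in> borel_measurable M"
    using assms by (auto simp: sq_integrable_def)
  let ?I = "\<integral>x. norm (f x) * norm (g x) \<partial>M"
  have I0: "0 \<le> ?I" by (simp add: integral_nonneg_AE)
  have "(\<integral>\<^sup>+x. ennreal (norm (f x)) * ennreal (norm (g x)) \<partial>M) = ennreal ?I"
    using nn_integral_eq_integral[OF integrable_norm_mult[OF assms]] by (simp add: ennreal_mult)
  then have "ennreal (?I\<^sup>2) \<le> ennreal ((l2norm M f)\<^sup>2) * ennreal ((l2norm M g)\<^sup>2)"
    using Cauchy_Schwarz_nn_integral[of "\<lambda>x. ennreal (norm (f x))" M "\<lambda>x. ennreal (norm (g x))"] I0
    by (simp add: ennreal_power nn_integral_norm_power2[symmetric] assms)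
  then have "?I\<^sup>2 \<le> (l2norm M f * l2norm M g)\<^sup>2"
    by (simp add: ennreal_mult[symmetric] power_mult_distrib)
  then show ?thesis
    by (rule power2_le_imp_le) simp
qed

lemma abs_integral_inner_le:
  assumes "sq_integrable M f" "sq_integrable M g"
  shows "\<bar>\<integral>x. f x \<bullet> g x \<partial>M\<bar> \<le> l2norm M f * l2norm M g"
proof -
  have "\<bar>\<integral>x. f x \<bullet> g x \<partial>M\<bar> \<le> (\<integral>x. norm (f x) * norm (g x) \<partial>M)"
    by (rule order_trans[OF integral_abs_bound integral_mono])
       (use integrable_inner[OF assms] integrable_norm_mult[OF assms] in \<open>auto simp: Cauchy_Schwarz_ineq2\<close>)
  also note Cauchy_Schwarz_l2norm[OF assms]
  finally show ?thesis .
qed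

lemma l2norm_triangle:
  assumes "sq_integrable M f" "sq_integrable M g"
  shows "l2norm M (\<lambda>x. f x + g x) \<le> l2norm M f + l2norm M g"
proof (rule power2_le_imp_le)
  have i: "integrable M (\<lambda>x. (norm (f x))\<^sup>2)" "integrable M (\<lambda>x. (norm (g x))\<^sup>2)"
    using assms by (auto simp: sq_integrable_def)
  have "(l2norm M (\<lambda>x. f x + g x))\<^sup>2
      = (\<integral>x. (norm (f x))\<^sup>2 + 2 * (f x \<bullet> g x) + (norm (g x))\<^sup>2 \<partial>M)"
    unfolding l2norm_power2
    by (simp add: power2_norm_eq_inner inner_add_left inner_add_right inner_commute algebra_simps)
  also have "\<dots> = (l2norm M f)\<^sup>2 + 2 * (\<integral>x. f x \<bullet> g x \<partial>M) + (l2norm M g)\<^sup>2"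
    using i integrable_inner[OF assms] by (simp add: l2norm_power2)
  also have "\<dots> \<le> (l2norm M f + l2norm M g)\<^sup>2"
    using abs_integral_inner_le[OF assms] by (simp add: power2_sum)
  finally show "(l2norm M (\<lambda>x. f x + g x))\<^sup>2 \<le> (l2norm M f + l2norm M g)\<^sup>2" .
qed simp

lemma l2norm_minus_commute: "l2norm M (\<lambda>x. f x - g x) = l2norm M (\<lambda>x. g x - f x)"
  by (simp add: l2norm_def norm_minus_commute)

lemma l2norm_diff_triangle:
  assumes "sq_integrable M f" "sq_integrable M g" "sq_integrable M h"
  shows "l2norm M (\<lambda>x. f x - h x) \<le> l2norm M (\<lambda>x. f x - g x) + l2norm M (\<lambda>x. g x - h x)"
  using l2norm_triangle[of M "\<lambda>x. f x - g x" "\<lambda>x. g x - h x"] assms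
  by (simp add: sq_integrable_diff)

lemma l2norm_reverse_triangle:
  assumes "sq_integrable M f" "sq_integrable M g"
  shows "\<bar>l2norm M f - l2norm M g\<bar> \<le> l2norm M (\<lambda>x. f x - g x)"
  using l2norm_triangle[OF sq_integrable_diff[OF assms] assms(2)]
    l2norm_triangle[OF sq_integrable_diff[OF assms(2,1)] assms(1)]
  by (simp add: l2norm_minus_commute[of M g f])

lemma l2norm_mono:
  fixes f :: "'x \<Rightarrow> 'v::euclidean_space" and g :: "'x \<Rightarrow> 'w::euclidean_space"
  assumes "sq_integrable M g" "f \<in> borel_measurable M" "\<And>x. norm (f x) \<le> c * norm (g x)" "0 \<le> c"
  shows "l2norm M f \<le> c * l2norm M g"
proof (rule power2_le_imp_le)
  have "sq_integrable M f" using assms sq_integrable_bound by blast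
  then have "(\<integral>x. (norm (f x))\<^sup>2 \<partial>M) \<le> (\<integral>x. c\<^sup>2 * (norm (g x))\<^sup>2 \<partial>M)"
    using assms(1) power_mono[OF assms(3), of _ 2]
    by (intro integral_mono) (auto simp: sq_integrable_def power_mult_distrib)
  then show "(l2norm M f)\<^sup>2 \<le> (c * l2norm M g)\<^sup>2"
    by (simp add: power_mult_distrib l2norm_power2)
qed (use assms in simp)

lemma l2norm_tendsto:
  assumes "\<And>k. sq_integrable M (h k)" "sq_integrable M f"
    and "(\<lambda>k. l2norm M (\<lambda>x. h k x - f x)) \<longlonglongrightarrow> 0"
  shows "(\<lambda>k. l2norm M (h k)) \<longlonglongrightarrow> l2norm M f"
proof -
  have "(\<lambda>k. l2norm M (h k) - l2norm M f) \<longlonglongrightarrow> 0"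
    by (rule Lim_null_comparison[OF _ assms(3)])
       (use l2norm_reverse_triangle[OF assms(1,2)] in auto)
  then show ?thesis by (simp add: LIM_zero_iff)
qed

text \<open>
  Used for two kinds of truncation: to balls \<open>S k\<close>, which makes a square integrable function
  integrable, and to the sets \<open>S k\<close> where \<open>\<bar>f\<bar> \<le> k\<close>, which makes it bounded.
\<close>

lemma l2norm_restrict_tendsto:
  fixes f :: "'x \<Rightarrow> 'v::euclidean_space" and S :: "nat \<Rightarrow> 'x set"
  assumes f: "sq_integrable M f" and S: "\<And>k. S k \<in> sets M"
    and cover: "\<And>x. x \<in> space M \<Longrightarrow> eventually (\<lambda>k. x \<in> S k) sequentially"
  shows "(\<lambda>k. l2norm M (\<lambda>x. indicat_real (S k) x *\<^sub>R f x - f x)) \<longlonglongrightarrow> 0"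
proof -
  have [measurable]: "f \<in> borel_measurable M" "\<And>k. S k \<in> sets M"
    using f S by (auto simp: sq_integrable_def)
  have "(\<lambda>k. \<integral>x. (norm (indicat_real (S k) x *\<^sub>R f x - f x))\<^sup>2 \<partial>M) \<longlonglongrightarrow> (\<integral>x. 0 \<partial>M)"
  proof (rule integral_dominated_convergence[where w = "\<lambda>x. (norm (f x))\<^sup>2"])
    show "integrable M (\<lambda>x. (norm (f x))\<^sup>2)" using f by (simp add: sq_integrable_def)
    show "AE x in M. (\<lambda>k. (norm (indicat_real (S k) x *\<^sub>R f x - f x))\<^sup>2) \<longlonglongrightarrow> 0"
    proof (rule AE_I2)
      fix x assume "x \<in> space M"
      then have "eventually (\<lambda>k. (norm (indicat_real (S k) x *\<^sub>R f x - f x))\<^sup>2 = 0) sequentially"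
        using cover[of x] by (auto elim!: eventually_mono)
      then show "(\<lambda>k. (norm (indicat_real (S k) x *\<^sub>R f x - f x))\<^sup>2) \<longlonglongrightarrow> 0"
        by (rule tendsto_eventually)
    qed
    show "AE x in M. norm ((norm (indicat_real (S k) x *\<^sub>R f x - f x))\<^sup>2) \<le> (norm (f x))\<^sup>2" for k
      by (rule AE_I2) (auto simp: indicator_def)
  qed measurable
  from tendsto_real_sqrt[OF this] show ?thesis
    by (simp add: l2norm_def)
qed

text \<open>
  Riesz--Fischer.  Along a subsequence with increments \<open>D\<^sub>k\<close> of norm at most \<open>2\<^bsup>-k\<^esup>\<close> the function
  \<open>\<Sum>\<^sub>k 2\<^sup>k D\<^sub>k\<^sup>2\<close> is integrable, hence finite almost everywhere; this forces \<open>\<Sum>\<^sub>k D\<^sub>k\<close> to converge, so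
  the subsequence converges almost everywhere.  Fatou's lemma compares its limit with the whole
  sequence.
\<close>

theorem l2_complete:
  fixes h :: "nat \<Rightarrow> 'x \<Rightarrow> 'v::euclidean_space"
  assumes sq: "\<And>k. sq_integrable M (h k)"
    and Cauchy: "\<And>e. 0 < e \<Longrightarrow> \<exists>N. \<forall>m\<ge>N. \<forall>n\<ge>N. l2norm M (\<lambda>x. h m x - h n x) < e"
  obtains g where "sq_integrable M g" "(\<lambda>k. l2norm M (\<lambda>x. h k x - g x)) \<longlonglongrightarrow> 0"
proof -
  have [measurable]: "\<And>k. h k \<in> borel_measurable M"
    using sq by (auto simp: sq_integrable_def)
  have "\<forall>k. \<exists>N. \<forall>m\<ge>N. \<forall>n\<ge>N. l2norm M (\<lambda>x. h m x - h n x) < (1/2)^k"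
    using Cauchy by simp
  then obtain N where N: "\<And>k m n. N k \<le> m \<Longrightarrow> N k \<le> n \<Longrightarrow> l2norm M (\<lambda>x. h m x - h n x) < (1/2)^k"
    by metis
  define r where "r k = (\<Sum>j\<le>k. N j) + k" for k
  have rN: "N k \<le> r k" for k
    unfolding r_def using member_le_sum[of k "{..k}" N] by simp
  have rSuc: "r k < r (Suc k)" for k
    by (simp add: r_def)
  then have r: "strict_mono r" by (rule strict_mono_Suc_iff[THEN iffD2, rule_format])
  define D where "D k x = norm (h (r (Suc k)) x - h (r k) x)" for k x
  have [measurable]: "D k \<in> borel_measurable M" for k unfolding D_def by measurable
  have D2: "(\<integral>\<^sup>+x. ennreal (2^k * (D k x)\<^sup>2) \<partial>M) \<le> ennreal ((1/2)^k)" for k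
  proof -
    have "l2norm M (\<lambda>x. h (r (Suc k)) x - h (r k) x) \<le> (1/2)^k"
      using N[of k "r (Suc k)" "r k"] rN[of k] rSuc[of k] by simp
    then have "(l2norm M (\<lambda>x. h (r (Suc k)) x - h (r k) x))\<^sup>2 \<le> ((1/2)^k)\<^sup>2"
      by (rule power_mono) simp
    then have "2^k * (l2norm M (\<lambda>x. h (r (Suc k)) x - h (r k) x))\<^sup>2 \<le> 2^k * ((1/2)^k)\<^sup>2"
      by (rule mult_left_mono) simp
    also have "\<dots> = (1/2)^k"
      by (simp add: power2_eq_square power_mult_distrib[symmetric] mult.assoc[symmetric])
    finally have "ennreal (2^k * (l2norm M (\<lambda>x. h (r (Suc k)) x - h (r k) x))\<^sup>2) \<le> ennreal ((1/2)^k)"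
      by (rule ennreal_leI)
    moreover have "(\<integral>\<^sup>+x. ennreal (2^k * (D k x)\<^sup>2) \<partial>M)
        = ennreal (2^k) * ennreal ((l2norm M (\<lambda>x. h (r (Suc k)) x - h (r k) x))\<^sup>2)"
      unfolding nn_integral_norm_power2[OF sq_integrable_diff[OF sq sq], symmetric] D_def
      by (simp add: ennreal_mult nn_integral_cmult)
    ultimately show ?thesis by (simp add: ennreal_mult)
  qed
  have "(\<integral>\<^sup>+x. (\<Sum>k. ennreal (2^k * (D k x)\<^sup>2)) \<partial>M) = (\<Sum>k. \<integral>\<^sup>+x. ennreal (2^k * (D k x)\<^sup>2) \<partial>M)"
    by (rule nn_integral_suminf) measurable
  also have "\<dots> \<le> (\<Sum>k. ennreal ((1/2)^k))"
    by (intro suminf_le D2) auto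
  also have "\<dots> = ennreal (\<Sum>k. (1/2)^k)"
    by (intro suminf_ennreal2) auto
  finally have "(\<integral>\<^sup>+x. (\<Sum>k. ennreal (2^k * (D k x)\<^sup>2)) \<partial>M) \<noteq> \<infinity>"
    by (auto simp: top_unique)
  then have "AE x in M. (\<Sum>k. ennreal (2^k * (D k x)\<^sup>2)) \<noteq> \<infinity>"
    by (intro nn_integral_noteq_infinite) auto
  then have conv: "AE x in M. convergent (\<lambda>k. h (r k) x)"
  proof (rule AE_mp, intro AE_I2 impI)
    fix x assume "(\<Sum>k. ennreal (2^k * (D k x)\<^sup>2)) \<noteq> \<infinity>"
    then have s: "summable (\<lambda>k. 2^k * (D k x)\<^sup>2)"
      by (intro summable_suminf_not_top) (auto simp: top_ennreal_def)
    \<comment> \<open>\<open>2 (2\<^sup>k D) \<le> (2\<^sup>k D)\<^sup>2 + 1\<close>, divided by \<open>2\<^sup>k\<close>, turns summability of the weighted squares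
      into summability of the increments themselves.\<close>
    have "norm (D k x) \<le> 2^k * (D k x)\<^sup>2 + (1/2)^k" for k
    proof -
      have "0 \<le> (2^k * D k x - 1)\<^sup>2" by simp
      then have "2 * (2^k * D k x) \<le> 2^k * (2^k * (D k x)\<^sup>2 + (1/2)^k)"
        by (simp add: power2_eq_square algebra_simps flip: power_mult_distrib)
      then have "2 * D k x \<le> 2^k * (D k x)\<^sup>2 + (1/2)^k"
        by (simp add: mult.left_commute[of 2])
      moreover have "0 \<le> D k x" by (simp add: D_def)
      ultimately show ?thesis by simp
    qed
    moreover have "summable (\<lambda>k. 2^k * (D k x)\<^sup>2 + (1/2)^k)"
      by (intro summable_add s) auto
    ultimately have "summable (\<lambda>k. D k x)"
      using summable_comparison_test'[of "\<lambda>k. 2^k * (D k x)\<^sup>2 + (1/2)^k" 0 "\<lambda>k. D k x"] by simp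
    then have "summable (\<lambda>k. h (r (Suc k)) x - h (r k) x)"
      unfolding D_def by (rule summable_norm_cancel)
    then have "convergent (\<lambda>k. \<Sum>j<k. h (r (Suc j)) x - h (r j) x)"
      by (simp add: summable_iff_convergent)
    then have "convergent (\<lambda>k. h (r k) x - h (r 0) x)"
      by (simp add: sum_lessThan_telescope[of "\<lambda>j. h (r j) x"])
    then have "convergent (\<lambda>k. (h (r k) x - h (r 0) x) + h (r 0) x)"
      by (intro convergent_add convergent_const)
    then show "convergent (\<lambda>k. h (r k) x)" by simp
  qed
  define g where "g x = lim (\<lambda>k. h (r k) x)" for x
  have [measurable]: "g \<in> borel_measurable M"
    unfolding g_def by (rule borel_measurable_lim_metric) measurable
  have lim: "AE x in M. (\<lambda>k. h (r k) x) \<longlonglongrightarrow> g x"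
    using conv by eventually_elim (simp add: g_def convergent_LIMSEQ_iff)
  have bound: "(\<integral>\<^sup>+x. ennreal ((norm (h m x - g x))\<^sup>2) \<partial>M) \<le> ennreal (e\<^sup>2)"
    if "0 < e" and M: "\<And>n. n0 \<le> n \<Longrightarrow> l2norm M (\<lambda>x. h m x - h n x) < e" for e m n0
  proof -
    have "(\<integral>\<^sup>+x. ennreal ((norm (h m x - g x))\<^sup>2) \<partial>M)
        = (\<integral>\<^sup>+x. liminf (\<lambda>k. ennreal ((norm (h m x - h (r k) x))\<^sup>2)) \<partial>M)"
    proof (rule nn_integral_cong_AE, use lim in eventually_elim)
      fix x assume "(\<lambda>k. h (r k) x) \<longlonglongrightarrow> g x"
      then have "(\<lambda>k. ennreal ((norm (h m x - h (r k) x))\<^sup>2)) \<longlonglongrightarrow> ennreal ((norm (h m x - g x))\<^sup>2)"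
        by (intro tendsto_ennrealI tendsto_intros)
      then show "ennreal ((norm (h m x - g x))\<^sup>2) = liminf (\<lambda>k. ennreal ((norm (h m x - h (r k) x))\<^sup>2))"
        using lim_imp_Liminf[OF sequentially_bot] by metis
    qed
    also have "\<dots> \<le> liminf (\<lambda>k. \<integral>\<^sup>+x. ennreal ((norm (h m x - h (r k) x))\<^sup>2) \<partial>M)"
      by (rule nn_integral_liminf) measurable
    also have "\<dots> \<le> limsup (\<lambda>k. \<integral>\<^sup>+x. ennreal ((norm (h m x - h (r k) x))\<^sup>2) \<partial>M)"
      by (rule Liminf_le_Limsup) simp
    also have "\<dots> \<le> ennreal (e\<^sup>2)"
    proof (rule Limsup_bounded, rule eventually_sequentiallyI[of n0])
      fix k assume "n0 \<le> k"
      then have "n0 \<le> r k" using seq_suble[OF r, of k] by simp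
      from M[OF this] show "(\<integral>\<^sup>+x. ennreal ((norm (h m x - h (r k) x))\<^sup>2) \<partial>M) \<le> ennreal (e\<^sup>2)"
        by (simp add: nn_integral_norm_power2 sq sq_integrable_diff power_mono)
    qed
    finally show ?thesis .
  qed
  have gsq: "sq_integrable M g"
  proof -
    obtain n0 where n0: "\<forall>m\<ge>n0. \<forall>n\<ge>n0. l2norm M (\<lambda>x. h m x - h n x) < 1"
      using Cauchy[of 1] by auto
    have "(\<integral>\<^sup>+x. ennreal ((norm (h n0 x - g x))\<^sup>2) \<partial>M) \<le> ennreal (1\<^sup>2)"
      by (rule bound[of 1 n0]) (use n0 in auto)
    then have "(\<integral>\<^sup>+x. ennreal (norm ((norm (h n0 x - g x))\<^sup>2)) \<partial>M) < \<infinity>"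
      by (simp add: le_less_trans)
    then have "integrable M (\<lambda>x. (norm (h n0 x - g x))\<^sup>2)"
      by (intro integrableI_bounded) measurable
    then have "sq_integrable M (\<lambda>x. h n0 x - g x)"
      by (simp add: sq_integrable_def)
    from sq_integrable_diff[OF sq[of n0] this] show ?thesis by (simp only: diff_diff_eq2 add_diff_cancel_left')
  qed
  show thesis
  proof (rule that[OF gsq])
    show "(\<lambda>k. l2norm M (\<lambda>x. h k x - g x)) \<longlonglongrightarrow> 0"
    proof (rule LIMSEQ_I)
      fix e :: real assume e0: "0 < e"
      then obtain n0 where n0: "\<forall>m\<ge>n0. \<forall>n\<ge>n0. l2norm M (\<lambda>x. h m x - h n x) < e/2"
        using Cauchy[of "e/2"] by auto
      show "\<exists>n0. \<forall>m\<ge>n0. norm (l2norm M (\<lambda>x. h m x - g x) - 0) < e"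
      proof (intro exI[of _ n0] allI impI)
        fix m assume m: "n0 \<le> m"
        have "(\<integral>\<^sup>+x. ennreal ((norm (h m x - g x))\<^sup>2) \<partial>M) \<le> ennreal ((e/2)\<^sup>2)"
        proof (rule bound[of _ n0])
          show "0 < e/2" using e0 by simp
          show "l2norm M (\<lambda>x. h m x - h n x) < e/2" if "n0 \<le> n" for n
            using n0 m that by blast
        qed
        then have "ennreal ((l2norm M (\<lambda>x. h m x - g x))\<^sup>2) \<le> ennreal ((e/2)\<^sup>2)"
          by (simp only: nn_integral_norm_power2[OF sq_integrable_diff[OF sq gsq]])
        then have "(l2norm M (\<lambda>x. h m x - g x))\<^sup>2 \<le> (e/2)\<^sup>2"
          by (subst (asm) ennreal_le_iff) auto
        then have "l2norm M (\<lambda>x. h m x - g x) \<le> e/2"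
          using e0 power2_le_imp_le[of "l2norm M (\<lambda>x. h m x - g x)" "e/2"] by linarith
        moreover have "0 \<le> l2norm M (\<lambda>x. h m x - g x)" by (rule l2norm_nonneg)
        ultimately show "norm (l2norm M (\<lambda>x. h m x - g x) - 0) < e"
          using e0 unfolding real_norm_def by linarith
      qed
    qed
  qed
qed

section \<open>Continuity of the autocorrelation\<close>

lemma lborel_shift:
  fixes f :: "'a::euclidean_space \<Rightarrow> 'b::{banach, second_countable_topology}"
  assumes [measurable]: "f \<in> borel_measurable borel"
  shows integrable_lborel_shift: "integrable lborel (\<lambda>x. f (x + t)) \<longleftrightarrow> integrable lborel f"
    and integral_lborel_shift: "(\<integral>x. f (x + t) \<partial>lborel) = (\<integral>x. f x \<partial>lborel)"
proof -
  show "integrable lborel (\<lambda>x. f (x + t)) \<longleftrightarrow> integrable lborel f"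
    using integrable_distr_eq[of "(+) t" lborel borel f] by (simp add: lborel_distr_plus add.commute)
  show "(\<integral>x. f (x + t) \<partial>lborel) = (\<integral>x. f x \<partial>lborel)"
    using integral_distr[of "(+) t" lborel borel f] by (simp add: lborel_distr_plus add.commute)
qed

lemma sq_integrable_lborel_shift:
  fixes f :: "'a::euclidean_space \<Rightarrow> 'b::euclidean_space"
  assumes "sq_integrable lborel f"
  shows "sq_integrable lborel (\<lambda>x. f (x + t))"
  using assms integrable_lborel_shift[of "\<lambda>x. (norm (f x))\<^sup>2" t] by (auto simp: sq_integrable_def)

lemma l2norm_lborel_shift:
  fixes f :: "'a::euclidean_space \<Rightarrow> 'b::euclidean_space"
  assumes "sq_integrable lborel f"
  shows "l2norm lborel (\<lambda>x. f (x + t)) = l2norm lborel f"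
  using assms integral_lborel_shift[of "\<lambda>x. (norm (f x))\<^sup>2" t]
  by (auto simp: l2norm_def sq_integrable_def)

text \<open>
  Regularity of Lebesgue measure encloses \<open>A\<close> between a closed and an open set whose difference is
  small; a Urysohn function for this pair approximates the indicator.
\<close>

lemma L1_approx_indicator:
  fixes A :: "'a::euclidean_space set" and c :: "'b::euclidean_space"
  assumes A: "A \<in> sets lborel" "emeasure lborel A < \<infinity>" and e: "0 < (e::real)"
  shows "\<exists>g. continuous_on UNIV g \<and> bounded (range g) \<and> integrable lborel g \<and>
    (\<integral>x. norm (indicator A x *\<^sub>R c - g x) \<partial>lborel) < e"
proof -
  define d where "d = e / (2 * (norm c + 1))"
  have d: "0 < d" using e by (auto simp: d_def intro!: divide_pos_pos add_nonneg_pos)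
  obtain U where U: "open U" "A \<subseteq> U" "emeasure lborel (U - A) < ennreal d"
    using outer_regular_lborel[of A d] A d by auto
  obtain V where V: "open V" "- A \<subseteq> V" "emeasure lborel (V - - A) < ennreal d"
    using outer_regular_lborel[of "- A" d] A d by auto
  obtain h :: "'a \<Rightarrow> real" where h: "continuous_on UNIV h" "\<And>x. h x \<in> closed_segment 1 0"
      "\<And>x. x \<in> - V \<Longrightarrow> h x = 1" "\<And>x. x \<in> - U \<Longrightarrow> h x = 0"
    using Urysohn[of "- V" "- U" "1::real" 0] U V by (auto simp: closed_Compl)
  have h01: "0 \<le> h x" "h x \<le> 1" for x
    using h(2)[of x] by (auto simp: closed_segment_eq_real_ivl)
  have [measurable]: "h \<in> borel_measurable borel" "A \<in> sets borel" "U \<in> sets borel" "V \<in> sets borel"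
    using h(1) A U V by (auto intro: borel_measurable_continuous_onI)
  have UA: "U - A \<in> fmeasurable lborel" and VA: "V - - A \<in> fmeasurable lborel"
    using U V by (auto intro!: fmeasurableI simp: top.not_eq_extremum dest: order.strict_trans[OF _ ennreal_less_top])
  have Af: "A \<in> fmeasurable lborel" using A by (auto intro!: fmeasurableI)
  have iA: "integrable lborel (indicat_real A)" "integrable lborel (indicat_real (U - A))"
     "integrable lborel (indicat_real (V - - A))"
    using UA VA Af by (auto simp: integrable_indicator_iff fmeasurable_def)
  have near: "\<bar>indicator A x - h x\<bar> \<le> indicator (U - A) x + indicator (V - - A) x" for x
    using h01[of x] h(3)[of x] h(4)[of x] U(2) by (auto simp: indicator_def)
  have inear: "integrable lborel (\<lambda>x. indicator A x - h x)"
    by (rule Bochner_Integration.integrable_bound[OF Bochner_Integration.integrable_add[OF iA(2,3)]])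
       (use near in \<open>auto intro: order_trans[OF near]\<close>)
  from Bochner_Integration.integrable_diff[OF iA(1) this]
  have ih: "integrable lborel h" by simp
  have "(\<integral>x. \<bar>indicator A x - h x\<bar> \<partial>lborel)
      \<le> (\<integral>x. indicat_real (U - A) x + indicat_real (V - - A) x \<partial>lborel)"
    by (intro integral_mono integrable_abs inear Bochner_Integration.integrable_add iA near)
  also have "\<dots> = measure lborel (U - A) + measure lborel (V - - A)"
    using iA by simp
  also have "\<dots> \<le> 2 * d"
    using U(3) V(3) UA VA d by (simp add: emeasure_eq_measure2 ennreal_less_iff)
  finally have le: "(\<integral>x. \<bar>indicator A x - h x\<bar> \<partial>lborel) \<le> 2 * d" .
  show ?thesis
  proof (intro exI[of _ "\<lambda>x. h x *\<^sub>R c"] conjI)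
    show "continuous_on UNIV (\<lambda>x. h x *\<^sub>R c)" by (intro continuous_intros h(1))
    have "norm (h x *\<^sub>R c) \<le> norm c" for x
      using mult_right_mono[OF h01(2)[of x] norm_ge_zero[of c]] h01(1)[of x] by simp
    then show "bounded (range (\<lambda>x. h x *\<^sub>R c))" by (auto intro!: boundedI)
    show "integrable lborel (\<lambda>x. h x *\<^sub>R c)" using ih by simp
    have "(\<integral>x. norm (indicator A x *\<^sub>R c - h x *\<^sub>R c) \<partial>lborel)
        = (\<integral>x. \<bar>indicator A x - h x\<bar> \<partial>lborel) * norm c"
      by (simp add: scaleR_diff_left[symmetric])
    also have "\<dots> \<le> 2 * d * norm c" by (intro mult_right_mono le) auto
    also have "\<dots> < e"
    proof -
      have "0 < norm c + 1" by (simp add: add_nonneg_pos)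
      then have "2 * d * (norm c + 1) = e" by (simp add: d_def del: distrib_left_numeral)
      moreover have "2 * d * norm c < 2 * d * (norm c + 1)" using d by simp
      ultimately show ?thesis by linarith
    qed
    finally show "(\<integral>x. norm (indicator A x *\<^sub>R c - h x *\<^sub>R c) \<partial>lborel) < e" .
  qed
qed

theorem L1_approx_bounded_continuous:
  fixes f :: "'a::euclidean_space \<Rightarrow> 'b::euclidean_space"
  assumes "integrable lborel f" "0 < (e::real)"
  obtains g where "continuous_on UNIV g" "bounded (range g)" "integrable lborel g"
    "(\<integral>x. norm (f x - g x) \<partial>lborel) < e"
proof -
  have "\<forall>e>0. \<exists>g. continuous_on UNIV g \<and> bounded (range g) \<and> integrable lborel g \<and>
    (\<integral>x. norm (f x - g x) \<partial>lborel) < e"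
    using assms(1)
  proof (induction rule: integrable_induct)
    case (base A c)
    then show ?case using L1_approx_indicator by blast
  next
    case (add f1 f2)
    show ?case
    proof (intro allI impI)
      fix e :: real assume "0 < e"
      then have e2: "0 < e/2" by simp
      obtain g1 where g1: "continuous_on UNIV g1" "bounded (range g1)" "integrable lborel g1"
        "(\<integral>x. norm (f1 x - g1 x) \<partial>lborel) < e/2" using add e2 by blast
      obtain g2 where g2: "continuous_on UNIV g2" "bounded (range g2)" "integrable lborel g2"
        "(\<integral>x. norm (f2 x - g2 x) \<partial>lborel) < e/2" using add e2 by blast
      have "(\<integral>x. norm (f1 x + f2 x - (g1 x + g2 x)) \<partial>lborel)
        \<le> (\<integral>x. norm (f1 x - g1 x) + norm (f2 x - g2 x) \<partial>lborel)"
        using add g1 g2 by (intro integral_mono) (auto simp: norm_diff_triangle_ineq)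
      also have "\<dots> = (\<integral>x. norm (f1 x - g1 x) \<partial>lborel) + (\<integral>x. norm (f2 x - g2 x) \<partial>lborel)"
        using add g1 g2 by (intro Bochner_Integration.integral_add) auto
      also have "\<dots> < e" using g1 g2 by simp
      finally have "(\<integral>x. norm (f1 x + f2 x - (g1 x + g2 x)) \<partial>lborel) < e" .
      moreover have "bounded (range (\<lambda>x. g1 x + g2 x))"
        using g1(2) g2(2) by (rule bounded_plus_comp)
      ultimately show "\<exists>g. continuous_on UNIV g \<and> bounded (range g) \<and> integrable lborel g \<and>
          (\<integral>x. norm (f1 x + f2 x - g x) \<partial>lborel) < e"
        using g1 g2 by (intro exI[of _ "\<lambda>x. g1 x + g2 x"]) (auto intro: continuous_on_add)
    qed
  next
    case (lim f s)
    show ?case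
    proof (intro allI impI)
      fix e :: real assume "0 < e"
      then have e2: "0 < e/2" by simp
      have [measurable]: "f \<in> borel_measurable borel" "\<And>i. s i \<in> borel_measurable borel"
        using lim by (auto dest: borel_measurable_integrable)
      have "(\<lambda>i. \<integral>x. norm (f x - s i x) \<partial>lborel) \<longlonglongrightarrow> (\<integral>x. 0 \<partial>(lborel :: 'a measure))"
      proof (rule integral_dominated_convergence[where w = "\<lambda>x. 3 * norm (f x)"])
        show "integrable lborel (\<lambda>x. 3 * norm (f x))" using lim by auto
        show "AE x in lborel. (\<lambda>i. norm (f x - s i x)) \<longlonglongrightarrow> 0"
        proof (rule AE_I2)
          fix x
          have "(\<lambda>i. norm (f x - s i x)) \<longlonglongrightarrow> norm (f x - f x)"
            using lim(2)[of x] by (intro tendsto_intros) auto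
          then show "(\<lambda>i. norm (f x - s i x)) \<longlonglongrightarrow> 0" by simp
        qed
        show "AE x in lborel. norm (norm (f x - s i x)) \<le> 3 * norm (f x)" for i
        proof (rule AE_I2)
          fix x
          show "norm (norm (f x - s i x)) \<le> 3 * norm (f x)"
            using norm_triangle_ineq4[of "f x" "s i x"] lim(3)[of x i] by simp
        qed
      qed measurable
      then have "(\<lambda>i. \<integral>x. norm (f x - s i x) \<partial>lborel) \<longlonglongrightarrow> 0" by simp
      then have "eventually (\<lambda>i. (\<integral>x. norm (f x - s i x) \<partial>lborel) < e/2) sequentially"
        using e2 by (rule order_tendstoD(2))
      then obtain i where i: "(\<integral>x. norm (f x - s i x) \<partial>lborel) < e/2"
        by (auto simp: eventually_sequentially)
      obtain g where g: "continuous_on UNIV g" "bounded (range g)" "integrable lborel g"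
        "(\<integral>x. norm (s i x - g x) \<partial>lborel) < e/2" using lim(5) e2 by blast
      have "(\<integral>x. norm (f x - g x) \<partial>lborel)
        \<le> (\<integral>x. norm (f x - s i x) + norm (s i x - g x) \<partial>lborel)"
        using lim(1,4) g norm_triangle_ineq[of "f x - s i x" "s i x - g x" for x]
        by (intro integral_mono) auto
      also have "\<dots> = (\<integral>x. norm (f x - s i x) \<partial>lborel) + (\<integral>x. norm (s i x - g x) \<partial>lborel)"
        using lim(1,4) g by (intro Bochner_Integration.integral_add) auto
      also have "\<dots> < e" using g i by simp
      finally show "\<exists>g. continuous_on UNIV g \<and> bounded (range g) \<and> integrable lborel g \<and>
          (\<integral>x. norm (f x - g x) \<partial>lborel) < e" using g by blast
    qed
  qed
  with assms(2) that show thesis by blast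
qed

text \<open>
  Write \<open>p\<close> for a bounded truncation of \<open>f\<close>, close to \<open>f\<close> in \<open>L\<^sup>2\<close>, and \<open>g\<close> for a bounded continuous
  function close to \<open>f\<close> in \<open>L\<^sup>1\<close>.  Replacing the left factor \<open>f(x)\<close> by \<open>p(x)\<close> costs little by
  Cauchy--Schwarz, and then replacing \<open>f(x+z)\<close> by \<open>g(x+z)\<close> costs little because \<open>p\<close> is bounded;
  both errors are uniform in \<open>z\<close>.  What remains, \<open>\<integral> p(x) \<cdot> g(x+z) dx\<close>, is continuous in \<open>z\<close> by
  dominated convergence.
\<close>

lemma autocorrelation_tendsto:
  fixes f :: "'a::euclidean_space \<Rightarrow> 'b::euclidean_space" and z :: "nat \<Rightarrow> 'a"
  assumes f1: "integrable lborel f" and f2: "sq_integrable lborel f" and z: "z \<longlonglongrightarrow> 0"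
  shows "(\<lambda>k. \<integral>x. f x \<bullet> f (x + z k) \<partial>lborel) \<longlonglongrightarrow> (\<integral>x. f x \<bullet> f x \<partial>lborel)"
proof (rule LIMSEQ_I)
  fix e :: real assume e: "0 < e"
  have [measurable]: "f \<in> borel_measurable borel" using f1 by auto
  note sh2 = sq_integrable_lborel_shift[OF f2] and shn = l2norm_lborel_shift[OF f2]
  define S where "S M = {x. norm (f x) \<le> real M}" for M :: nat
  have S[measurable]: "S M \<in> sets borel" for M unfolding S_def by measurable
  \<comment> \<open>Each of the two replacements below costs at most \<open>e / 8\<close>, for every shift; the summand \<open>1\<close> keeps
    the denominators positive.\<close>
  define d where "d = e / (8 * (l2norm lborel f + 1))"
  have d: "0 < d" using e by (auto simp: d_def intro!: divide_pos_pos add_nonneg_pos)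
  have "(\<lambda>M. l2norm lborel (\<lambda>x. indicat_real (S M) x *\<^sub>R f x - f x)) \<longlonglongrightarrow> 0"
  proof (rule l2norm_restrict_tendsto[OF f2])
    fix x :: 'a
    obtain N where "norm (f x) \<le> real N" using real_arch_simple by blast
    then show "eventually (\<lambda>M. x \<in> S M) sequentially"
      by (intro eventually_sequentiallyI[of N]) (auto simp: S_def)
  qed simp
  then have "eventually (\<lambda>M. l2norm lborel (\<lambda>x. indicat_real (S M) x *\<^sub>R f x - f x) < d) sequentially"
    using d by (auto dest: order_tendstoD(2))
  then obtain M where M: "l2norm lborel (\<lambda>x. indicat_real (S M) x *\<^sub>R f x - f x) < d"
    by (auto simp: eventually_sequentially)
  define p where "p x = indicat_real (S M) x *\<^sub>R f x" for x
  have pm[measurable]: "p \<in> borel_measurable borel" unfolding p_def by measurable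
  have pM: "norm (p x) \<le> real M" for x by (auto simp: p_def indicator_def S_def)
  have p1: "integrable lborel p"
    by (rule Bochner_Integration.integrable_bound[OF f1]) (auto simp: p_def indicator_def)
  have p2: "sq_integrable lborel p"
    by (rule sq_integrable_bound[OF f2, of _ 1]) (auto simp: p_def indicator_def)
  define b where "b = e / (8 * (real M + 1))"
  have b: "0 < b" using e by (auto simp: b_def intro!: divide_pos_pos add_nonneg_pos)
  obtain g where g: "continuous_on UNIV g" "bounded (range g)" "integrable lborel g"
    "(\<integral>x. norm (f x - g x) \<partial>lborel) < b" using L1_approx_bounded_continuous[OF f1 b] by blast
  have [measurable]: "g \<in> borel_measurable borel" using g by auto
  obtain K where K: "\<And>x. norm (g x) \<le> K" using g(2) by (auto simp: bounded_iff)
  have bnd: "integrable lborel (\<lambda>x. p x \<bullet> q (x + t))"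
    "\<bar>\<integral>x. p x \<bullet> q (x + t) \<partial>lborel\<bar> \<le> real M * (\<integral>x. norm (q x) \<partial>lborel)"
    if q: "integrable lborel q" for q :: "'a \<Rightarrow> 'b" and t
  proof -
    have [measurable]: "q \<in> borel_measurable borel" using q by auto
    have qn: "integrable lborel (\<lambda>x. real M * norm (q (x + t)))"
      using integrable_lborel_shift[of q t] q by auto
    have le: "\<bar>p x \<bullet> q (x + t)\<bar> \<le> real M * norm (q (x + t))" for x
      by (rule order_trans[OF Cauchy_Schwarz_ineq2 mult_right_mono[OF pM]]) simp
    show i: "integrable lborel (\<lambda>x. p x \<bullet> q (x + t))"
      by (rule Bochner_Integration.integrable_bound[OF qn]) (use le in \<open>auto\<close>)
    have "\<bar>\<integral>x. p x \<bullet> q (x + t) \<partial>lborel\<bar> \<le> (\<integral>x. real M * norm (q (x + t)) \<partial>lborel)"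
      by (rule order_trans[OF integral_abs_bound integral_mono]) (use i qn le in auto)
    also have "\<dots> = real M * (\<integral>x. norm (q x) \<partial>lborel)"
      using integral_lborel_shift[of "\<lambda>x. norm (q x)" t] by simp
    finally show "\<bar>\<integral>x. p x \<bullet> q (x + t) \<partial>lborel\<bar> \<le> real M * (\<integral>x. norm (q x) \<partial>lborel)" .
  qed
  have "(\<lambda>k. \<integral>x. p x \<bullet> g (x + z k) \<partial>lborel) \<longlonglongrightarrow> (\<integral>x. p x \<bullet> g x \<partial>lborel)"
  proof (rule integral_dominated_convergence[where w = "\<lambda>x. K * norm (p x)"])
    show "integrable lborel (\<lambda>x. K * norm (p x))" using p1 by auto
    show "AE x in lborel. (\<lambda>k. p x \<bullet> g (x + z k)) \<longlonglongrightarrow> p x \<bullet> g x"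
    proof (rule AE_I2)
      fix x :: 'a
      have "(\<lambda>k. x + z k) \<longlonglongrightarrow> x + 0" by (intro tendsto_intros z)
      then have "(\<lambda>k. g (x + z k)) \<longlonglongrightarrow> g x"
        using continuous_on_tendsto_compose[OF g(1)] by auto
      then show "(\<lambda>k. p x \<bullet> g (x + z k)) \<longlonglongrightarrow> p x \<bullet> g x" by (intro tendsto_intros)
    qed
    show "AE x in lborel. norm (p x \<bullet> g (x + z k)) \<le> K * norm (p x)" for k
    proof (rule AE_I2)
      fix x :: 'a
      have "\<bar>p x \<bullet> g (x + z k)\<bar> \<le> norm (p x) * norm (g (x + z k))" by (rule Cauchy_Schwarz_ineq2)
      also have "\<dots> \<le> norm (p x) * K" by (rule mult_left_mono[OF K]) simp
      finally show "norm (p x \<bullet> g (x + z k)) \<le> K * norm (p x)" by (simp add: mult.commute)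
    qed
  qed measurable
  from LIMSEQ_D[OF this, of "e / 4"] e obtain k0 where k0: "\<And>k. k \<ge> k0 \<Longrightarrow>
      \<bar>(\<integral>x. p x \<bullet> g (x + z k) \<partial>lborel) - (\<integral>x. p x \<bullet> g x \<partial>lborel)\<bar> < e / 4"
    unfolding real_norm_def by (metis divide_pos_pos zero_less_numeral)
  have split: "(\<integral>x. f x \<bullet> f (x + t) \<partial>lborel) - (\<integral>x. p x \<bullet> g (x + t) \<partial>lborel)
    = (\<integral>x. (f x - p x) \<bullet> f (x + t) \<partial>lborel) + (\<integral>x. p x \<bullet> (f (x + t) - g (x + t)) \<partial>lborel)" for t
  proof -
    have i: "integrable lborel (\<lambda>x. f x \<bullet> f (x + t))" "integrable lborel (\<lambda>x. p x \<bullet> f (x + t))"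
      "integrable lborel (\<lambda>x. p x \<bullet> g (x + t))"
      using integrable_inner[OF f2 sh2] integrable_inner[OF p2 sh2] bnd(1)[OF g(3)] by auto
    show ?thesis using i by (simp add: inner_diff_left inner_diff_right)
  qed
  have close: "\<bar>(\<integral>x. f x \<bullet> f (x + t) \<partial>lborel) - (\<integral>x. p x \<bullet> g (x + t) \<partial>lborel)\<bar> \<le> e / 4" for t
  proof -
    have "\<bar>\<integral>x. (f x - p x) \<bullet> f (x + t) \<partial>lborel\<bar> \<le> l2norm lborel (\<lambda>x. f x - p x) * l2norm lborel f"
      using abs_integral_inner_le[OF sq_integrable_diff[OF f2 p2] sh2[of t]] by (simp add: shn)
    also have "\<dots> \<le> d * l2norm lborel f"
      using M by (intro mult_right_mono) (auto simp: p_def l2norm_minus_commute[of _ f])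
    also have "\<dots> \<le> d * (l2norm lborel f + 1)" using d by simp
    also have "\<dots> = e / 8"
      using l2norm_nonneg[of lborel f] unfolding d_def by (simp add: field_simps add_nonneg_eq_0_iff)
    finally have 1: "\<bar>\<integral>x. (f x - p x) \<bullet> f (x + t) \<partial>lborel\<bar> \<le> e / 8" .
    have "\<bar>\<integral>x. p x \<bullet> (f (x + t) - g (x + t)) \<partial>lborel\<bar> \<le> real M * (\<integral>x. norm (f x - g x) \<partial>lborel)"
      using bnd(2)[of "\<lambda>x. f x - g x" t] f1 g(3) by simp
    also have "\<dots> \<le> real M * b" using g(4) by (intro mult_left_mono) auto
    also have "\<dots> \<le> (real M + 1) * b" using b by simp
    also have "\<dots> = e / 8" unfolding b_def by (simp add: field_simps)
    finally have 2: "\<bar>\<integral>x. p x \<bullet> (f (x + t) - g (x + t)) \<partial>lborel\<bar> \<le> e / 8" .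
    from 1 2 show ?thesis unfolding split by linarith
  qed
  show "\<exists>k0. \<forall>k\<ge>k0. norm ((\<integral>x. f x \<bullet> f (x + z k) \<partial>lborel) - (\<integral>x. f x \<bullet> f x \<partial>lborel)) < e"
  proof (intro exI[of _ k0] allI impI)
    fix k assume "k0 \<le> k"
    from k0[OF this] close[of "z k"] close[of 0]
    show "norm ((\<integral>x. f x \<bullet> f (x + z k) \<partial>lborel) - (\<integral>x. f x \<bullet> f x \<partial>lborel)) < e"
      unfolding real_norm_def add_0_right using e by linarith
  qed
qed

section \<open>The Fourier transform of the Gaussian\<close>

lemma lborel_integral_Basis_prod:
  fixes \<phi> :: "'a::euclidean_space \<Rightarrow> real \<Rightarrow> 'b::{real_normed_field, banach, second_countable_topology}"
  assumes int: "\<And>b. b \<in> Basis \<Longrightarrow> integrable lborel (\<phi> b)"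
  shows integrable_lborel_Basis_prod: "integrable lborel (\<lambda>x. \<Prod>b\<in>Basis. \<phi> b (x \<bullet> b))"
    and "(\<integral>x. (\<Prod>b\<in>Basis. \<phi> b (x \<bullet> b)) \<partial>lborel) = (\<Prod>b\<in>Basis. \<integral>t. \<phi> b t \<partial>lborel)"
proof -
  interpret product_sigma_finite "\<lambda>_::'a. lborel :: real measure" by standard
  have [measurable]: "\<phi> b \<in> borel_measurable borel" if "b \<in> Basis" for b
    using int[OF that] by auto
  let ?T = "\<lambda>f. \<Sum>b\<in>(Basis :: 'a set). f b *\<^sub>R b"
  have comp: "(\<Prod>b\<in>Basis. \<phi> b (?T f \<bullet> b)) = (\<Prod>b\<in>Basis. \<phi> b (f b))" for f
    by (intro prod.cong refl) simp
  have [measurable]: "(\<lambda>x::'a. \<Prod>b\<in>Basis. \<phi> b (x \<bullet> b)) \<in> borel_measurable borel" by measurable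
  have [measurable]: "?T \<in> (\<Pi>\<^sub>M b\<in>Basis. lborel) \<rightarrow>\<^sub>M borel" by measurable
  show "integrable lborel (\<lambda>x. \<Prod>b\<in>Basis. \<phi> b (x \<bullet> b))"
    by (subst lborel_eq, subst integrable_distr_eq)
       (auto simp: comp intro!: product_integrable_prod int)
  show "(\<integral>x. (\<Prod>b\<in>Basis. \<phi> b (x \<bullet> b)) \<partial>lborel) = (\<Prod>b\<in>Basis. \<integral>t. \<phi> b t \<partial>lborel)"
    by (subst lborel_eq, subst integral_distr) (auto simp: comp intro!: product_integral_prod int)
qed

definition gaussian :: "'a::euclidean_space \<Rightarrow> real" where
  "gaussian w = exp (- (norm w)\<^sup>2 / 2)"

lemma gaussian_measurable [measurable]: "gaussian \<in> borel_measurable borel"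
  unfolding gaussian_def by measurable

lemma gaussian_nonneg [simp]: "0 \<le> gaussian w"
  by (simp add: gaussian_def)

lemma cis_gaussian_Basis_prod:
  "cis (u \<bullet> w) * of_real (gaussian w)
    = (\<Prod>b\<in>Basis. cis ((u \<bullet> b) * (w \<bullet> b)) * of_real (exp (- (w \<bullet> b)\<^sup>2 / 2)))"
proof -
  have "cis (u \<bullet> w) = (\<Prod>b\<in>Basis. cis ((u \<bullet> b) * (w \<bullet> b)))"
    by (subst euclidean_inner) (simp add: cis_conv_exp sum_distrib_left exp_sum)
  moreover have "gaussian w = (\<Prod>b\<in>Basis. exp (- (w \<bullet> b)\<^sup>2 / 2))"
    unfolding gaussian_def power2_norm_eq_inner
    by (subst euclidean_inner) (simp add: power2_eq_square sum_negf[symmetric] sum_divide_distrib exp_sum)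
  ultimately show ?thesis by (simp add: prod.distrib)
qed

lemma cis_measurable [measurable]: "cis \<in> borel_measurable borel"
  by (intro borel_measurable_continuous_onI continuous_intros)

text \<open>
  The characteristic function of the standard normal distribution, without its normalisation.
\<close>

lemma gaussian_transform_real:
  fixes t :: real
  shows "integrable lborel (\<lambda>x. cis (t * x) * of_real (exp (- x\<^sup>2 / 2)))"
    and "(\<integral>x. cis (t * x) * of_real (exp (- x\<^sup>2 / 2)) \<partial>lborel) = of_real (sqrt (2 * pi) * exp (- t\<^sup>2 / 2))"
proof -
  have d: "cis (t * x) * of_real (exp (- x\<^sup>2 / 2))
      = of_real (sqrt (2 * pi)) * (std_normal_density x *\<^sub>R cis (t * x))" for x
    by (simp add: std_normal_density_def scaleR_conv_of_real)
  have "integrable lborel (\<lambda>x. std_normal_density x *\<^sub>R cis (t * x))"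
    by (rule Bochner_Integration.integrable_bound[OF integrable_normal_density[of 1 0]])
       auto
  then show "integrable lborel (\<lambda>x. cis (t * x) * of_real (exp (- x\<^sup>2 / 2)))"
    unfolding d by (rule integrable_mult_right)
  have "(\<integral>x. std_normal_density x *\<^sub>R cis (t * x) \<partial>lborel) = char std_normal_distribution t"
    unfolding char_def cis_conv_exp
    by (subst integral_density) (auto simp: ac_simps)
  then show "(\<integral>x. cis (t * x) * of_real (exp (- x\<^sup>2 / 2)) \<partial>lborel)
      = of_real (sqrt (2 * pi) * exp (- t\<^sup>2 / 2))"
    unfolding d integral_mult_right_zero by (simp only: char_std_normal_distribution of_real_mult)
qed

text \<open>
  Both the character \<open>cis (u \<cdot> w)\<close> and the Gaussian factor over the coordinates of \<open>w\<close>, which reduces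
  the integral to the real line.
\<close>

lemma gaussian_transform:
  fixes u :: "'a::euclidean_space"
  shows "integrable lborel (\<lambda>w. cis (u \<bullet> w) * of_real (gaussian w))"
    and "(\<integral>w. cis (u \<bullet> w) * of_real (gaussian w) \<partial>lborel)
      = of_real (sqrt (2 * pi) ^ DIM('a) * gaussian u)"
proof -
  show "integrable lborel (\<lambda>w. cis (u \<bullet> w) * of_real (gaussian w))"
    unfolding cis_gaussian_Basis_prod
    by (rule integrable_lborel_Basis_prod) (rule gaussian_transform_real)
  have "(\<integral>w. cis (u \<bullet> w) * of_real (gaussian w) \<partial>lborel)
      = (\<Prod>b\<in>(Basis::'a set). of_real (sqrt (2 * pi) * exp (- (u \<bullet> b)\<^sup>2 / 2)))"
    unfolding cis_gaussian_Basis_prod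
    by (subst lborel_integral_Basis_prod) (simp_all only: gaussian_transform_real)
  also have "\<dots> = of_real (sqrt (2 * pi) ^ DIM('a) * gaussian u)"
    unfolding gaussian_def power2_norm_eq_inner
    by (subst (2) euclidean_inner)
       (simp add: prod.distrib power2_eq_square sum_negf[symmetric] sum_divide_distrib exp_sum)
  finally show "(\<integral>w. cis (u \<bullet> w) * of_real (gaussian w) \<partial>lborel)
      = of_real (sqrt (2 * pi) ^ DIM('a) * gaussian u)" .
qed

lemma gaussian_cos_sin_transform:
  fixes u :: "'a::euclidean_space"
  shows "integrable lborel (\<lambda>w. cos (u \<bullet> w) * gaussian w)"
    and "integrable lborel (\<lambda>w. sin (u \<bullet> w) * gaussian w)"
    and "(\<integral>w. cos (u \<bullet> w) * gaussian w \<partial>lborel) = sqrt (2 * pi) ^ DIM('a) * gaussian u"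
    and "(\<integral>w. sin (u \<bullet> w) * gaussian w \<partial>lborel) = 0"
  using integrable_Re[OF gaussian_transform(1)[of u]] integrable_Im[OF gaussian_transform(1)[of u]]
    integral_Re[OF gaussian_transform(1)[of u]] integral_Im[OF gaussian_transform(1)[of u]]
  by (simp_all add: gaussian_transform(2))

lemma integrable_gaussian: "integrable lborel (gaussian :: 'a::euclidean_space \<Rightarrow> real)"
  and integral_gaussian: "(\<integral>w. gaussian (w::'a) \<partial>lborel) = sqrt (2 * pi) ^ DIM('a)"
  using gaussian_cos_sin_transform(1,3)[of "0::'a"] gaussian_def[of "0::'a"] by simp_all

lemma lborel_affine_integral:
  fixes f :: "'a::euclidean_space \<Rightarrow> 'b::{banach, second_countable_topology}"
  assumes [measurable]: "f \<in> borel_measurable borel" and c: "0 < c"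
  shows integrable_lborel_affine: "integrable lborel (\<lambda>x. f (t + c *\<^sub>R x)) \<longleftrightarrow> integrable lborel f"
    and integral_lborel_affine: "(\<integral>x. f x \<partial>lborel) = c ^ DIM('a) *\<^sub>R (\<integral>x. f (t + c *\<^sub>R x) \<partial>lborel)"
proof -
  have l: "lborel = density (distr lborel borel (\<lambda>x. t + c *\<^sub>R x)) (\<lambda>_. c ^ DIM('a))"
    using lborel_affine[of c t] c by (simp add: ennreal_power)
  have "integrable lborel f \<longleftrightarrow> integrable (density (distr lborel borel (\<lambda>x. t + c *\<^sub>R x)) (\<lambda>_. c ^ DIM('a))) f"
    using l by simp
  also have "\<dots> \<longleftrightarrow> integrable (distr lborel borel (\<lambda>x. t + c *\<^sub>R x)) (\<lambda>x. c ^ DIM('a) *\<^sub>R f x)"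
    using c by (subst integrable_density) auto
  also have "\<dots> \<longleftrightarrow> integrable lborel (\<lambda>x. f (t + c *\<^sub>R x))"
    using c integrable_scaleR_right[of "inverse (c ^ DIM('a))" lborel "\<lambda>x. c ^ DIM('a) *\<^sub>R f (t + c *\<^sub>R x)"]
    by (subst integrable_distr_eq) auto
  finally show "integrable lborel (\<lambda>x. f (t + c *\<^sub>R x)) \<longleftrightarrow> integrable lborel f" by simp
  have "(\<integral>x. f x \<partial>lborel) = (\<integral>x. f x \<partial>density (distr lborel borel (\<lambda>x. t + c *\<^sub>R x)) (\<lambda>_. c ^ DIM('a)))"
    using l by simp
  also have "\<dots> = (\<integral>x. c ^ DIM('a) *\<^sub>R f x \<partial>distr lborel borel (\<lambda>x. t + c *\<^sub>R x))"
    using c by (subst integral_density) auto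
  also have "\<dots> = c ^ DIM('a) *\<^sub>R (\<integral>x. f (t + c *\<^sub>R x) \<partial>lborel)"
    by (subst integral_distr) auto
  finally show "(\<integral>x. f x \<partial>lborel) = c ^ DIM('a) *\<^sub>R (\<integral>x. f (t + c *\<^sub>R x) \<partial>lborel)" .
qed

section \<open>Plancherel's identity\<close>

lemma (in pair_sigma_finite) integrable_tensor:
  fixes f :: "'a \<Rightarrow> real" and g :: "'b \<Rightarrow> real"
  assumes "integrable M1 f" "integrable M2 g"
  shows "integrable (M1 \<Otimes>\<^sub>M M2) (\<lambda>(x, y). f x * g y)"
proof (rule Fubini_integrable)
  have [measurable]: "f \<in> borel_measurable M1" "g \<in> borel_measurable M2" using assms by auto
  show "(\<lambda>(x, y). f x * g y) \<in> borel_measurable (M1 \<Otimes>\<^sub>M M2)" by measurable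
  show "integrable M1 (\<lambda>x. \<integral>y. norm (case (x, y) of (x, y) \<Rightarrow> f x * g y) \<partial>M2)"
    using assms by (simp add: abs_mult)
  show "AE x in M1. integrable M2 (\<lambda>y. case (x, y) of (x, y) \<Rightarrow> f x * g y)"
    using assms by simp
qed

lemma gaussian_scaled:
  fixes u :: "'a::euclidean_space"
  assumes "0 < \<epsilon>"
  shows "integrable lborel (\<lambda>w. cos (u \<bullet> w) * gaussian (\<epsilon> *\<^sub>R w))"
    and "integrable lborel (\<lambda>w. sin (u \<bullet> w) * gaussian (\<epsilon> *\<^sub>R w))"
    and "integrable lborel (\<lambda>w::'a. gaussian (\<epsilon> *\<^sub>R w))"
    and "(\<integral>w. cos (u \<bullet> w) * gaussian (\<epsilon> *\<^sub>R w) \<partial>lborel)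
      = (sqrt (2 * pi) / \<epsilon>) ^ DIM('a) * gaussian (u /\<^sub>R \<epsilon>)"
    and "(\<integral>w. sin (u \<bullet> w) * gaussian (\<epsilon> *\<^sub>R w) \<partial>lborel) = 0"
proof -
  have e: "0 < inverse \<epsilon>" using assms by simp
  have e': "\<epsilon> \<noteq> 0" using assms by simp
  note af = integrable_lborel_affine[OF _ e, of _ 0] integral_lborel_affine[OF _ e, of _ 0]
  show "integrable lborel (\<lambda>w. cos (u \<bullet> w) * gaussian (\<epsilon> *\<^sub>R w))"
    using af(1)[of "\<lambda>w. cos (u \<bullet> w) * gaussian (\<epsilon> *\<^sub>R w)"] e'
      gaussian_cos_sin_transform(1)[of "u /\<^sub>R \<epsilon>"] by simp
  show "integrable lborel (\<lambda>w. sin (u \<bullet> w) * gaussian (\<epsilon> *\<^sub>R w))"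
    using af(1)[of "\<lambda>w. sin (u \<bullet> w) * gaussian (\<epsilon> *\<^sub>R w)"] e'
      gaussian_cos_sin_transform(2)[of "u /\<^sub>R \<epsilon>"] by simp
  show "integrable lborel (\<lambda>w::'a. gaussian (\<epsilon> *\<^sub>R w))"
    using af(1)[of "\<lambda>w::'a. gaussian (\<epsilon> *\<^sub>R w)"] e' integrable_gaussian[where 'a = 'a] by simp
  show "(\<integral>w. cos (u \<bullet> w) * gaussian (\<epsilon> *\<^sub>R w) \<partial>lborel)
      = (sqrt (2 * pi) / \<epsilon>) ^ DIM('a) * gaussian (u /\<^sub>R \<epsilon>)"
    using af(2)[of "\<lambda>w. cos (u \<bullet> w) * gaussian (\<epsilon> *\<^sub>R w)"] e'
      gaussian_cos_sin_transform(3)[of "u /\<^sub>R \<epsilon>"] by (simp add: power_mult_distrib divide_inverse)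
  show "(\<integral>w. sin (u \<bullet> w) * gaussian (\<epsilon> *\<^sub>R w) \<partial>lborel) = 0"
    using af(2)[of "\<lambda>w. sin (u \<bullet> w) * gaussian (\<epsilon> *\<^sub>R w)"] e'
      gaussian_cos_sin_transform(4)[of "u /\<^sub>R \<epsilon>"] by simp
qed

text \<open>
  A complex structure on a Euclidean space for which \<open>exp (\<theta> J)\<close> is a rotation.  It is given as a map
  and not as a complex vector space, so that the values of functions and their Bochner integrals stay
  in the original Euclidean space.
\<close>

locale orthogonal_complex_structure =
  fixes J :: "'v::euclidean_space \<Rightarrow> 'v"
  assumes linear_J: "linear J"
    and J_J: "J (J v) = - v"
    and J_skew: "J u \<bullet> v = - (u \<bullet> J v)"
begin

text \<open>
  The action of \<open>exp (- \<theta> J)\<close>.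
\<close>

definition rot :: "real \<Rightarrow> 'v \<Rightarrow> 'v" where
  "rot \<theta> v = cos \<theta> *\<^sub>R v - sin \<theta> *\<^sub>R J v"

definition fourier :: "('a::euclidean_space \<Rightarrow> 'v) \<Rightarrow> 'a \<Rightarrow> 'v" where
  "fourier f w = (\<integral>x. rot (x \<bullet> w) (f x) \<partial>lebesgue)"

lemma J_simps: "J (u + v) = J u + J v" "J (u - v) = J u - J v" "J (c *\<^sub>R v) = c *\<^sub>R J v"
  using linear_J by (auto simp: linear_add linear_diff linear_scale)

lemma inner_rot:
  "rot \<alpha> u \<bullet> rot \<beta> v = cos (\<beta> - \<alpha>) * (u \<bullet> v) - sin (\<beta> - \<alpha>) * (u \<bullet> J v)"
  by (simp add: rot_def inner_diff_left inner_diff_right J_skew J_J cos_diff sin_diff algebra_simps)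

lemma norm_rot: "norm (rot \<theta> v) = norm v"
  by (simp add: norm_eq_sqrt_inner inner_rot)

lemma rot_add: "rot \<alpha> (rot \<beta> v) = rot (\<alpha> + \<beta>) v"
  by (simp add: rot_def J_simps J_J cos_add sin_add algebra_simps)

lemma linear_rot: "linear (rot \<theta>)"
  by (rule linearI) (simp_all add: rot_def J_simps algebra_simps)

lemma bounded_linear_rot: "bounded_linear (rot \<theta>)"
  using linear_rot linear_conv_bounded_linear by blast

lemma measurable_J [measurable]: "J \<in> borel_measurable borel"
  using linear_J by (intro borel_measurable_continuous_onI linear_continuous_on)
    (simp add: linear_conv_bounded_linear)

lemma measurable_rot [measurable (raw)]:
  assumes [measurable]: "h \<in> borel_measurable M" "f \<in> borel_measurable M"
  shows "(\<lambda>x. rot (h x) (f x)) \<in> borel_measurable M"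
  unfolding rot_def by measurable

lemma integrable_rot:
  assumes "integrable M f" "h \<in> borel_measurable M"
  shows "integrable M (\<lambda>x. rot (h x) (f x))"
  by (rule Bochner_Integration.integrable_bound[OF assms(1)])
     (use assms in \<open>auto simp: norm_rot\<close>)

text \<open>
  Expanding \<open>\<bar>F(w)\<bar>\<^sup>2\<close> as a double integral over \<open>(x, y)\<close> and integrating over \<open>w\<close> first, only the
  cosine part survives and produces the Gaussian kernel \<open>K\<close> of width \<open>\<epsilon>\<close> in \<open>y - x\<close>.  The
  substitution \<open>y = x + \<epsilon> u\<close> cancels the factor \<open>\<epsilon>\<^bsup>-n\<^esup>\<close> of \<open>K\<close> and moves \<open>\<epsilon>\<close> into the argument of the
  autocorrelation, which is where the limit \<open>\<epsilon> \<rightarrow> 0\<close> can be taken.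
\<close>

lemma gaussian_regularised_energy:
  fixes f :: "'a::euclidean_space \<Rightarrow> 'v"
  assumes f1: "integrable lborel f" and f2: "sq_integrable lborel f" and e: "0 < \<epsilon>"
  defines "F \<equiv> (\<lambda>w. \<integral>x. rot (x \<bullet> w) (f x) \<partial>lborel)"
  shows "integrable lborel (\<lambda>w. gaussian (\<epsilon> *\<^sub>R w) * (norm (F w))\<^sup>2)"
    and "(\<integral>w. gaussian (\<epsilon> *\<^sub>R w) * (norm (F w))\<^sup>2 \<partial>lborel)
      = (\<integral>u. sqrt (2 * pi) ^ DIM('a) * gaussian u * (\<integral>x. f x \<bullet> f (x + \<epsilon> *\<^sub>R u) \<partial>lborel) \<partial>lborel)"
proof -
  have [measurable]: "f \<in> borel_measurable borel" using f1 by auto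
  note fr = integrable_rot[OF f1]
  define H where "H w p = rot (fst p \<bullet> w) (f (fst p)) \<bullet> rot (snd p \<bullet> w) (f (snd p))" for w and p :: "'a \<times> 'a"
  have "(\<lambda>(w, p). H w p) \<in> borel_measurable (borel \<Otimes>\<^sub>M (borel \<Otimes>\<^sub>M borel))"
    unfolding H_def by measurable
  then have Hm: "(\<lambda>(w, p). H w p) \<in> borel_measurable (borel \<Otimes>\<^sub>M borel)"
    by (simp add: borel_prod)
  have "H w \<in> borel_measurable (borel \<Otimes>\<^sub>M borel)" for w
    unfolding H_def by measurable
  then have Hm1: "H w \<in> borel_measurable borel" for w
    by (simp add: borel_prod)
  have Hle: "\<bar>H w p\<bar> \<le> norm (f (fst p)) * norm (f (snd p))" for w p
    unfolding H_def by (rule order_trans[OF Cauchy_Schwarz_ineq2]) (simp add: norm_rot)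
  have ff: "integrable lborel (\<lambda>p::'a\<times>'a. norm (f (fst p)) * norm (f (snd p)))"
    using lborel_pair.integrable_tensor[OF integrable_norm[OF f1] integrable_norm[OF f1]]
    by (simp add: lborel_prod case_prod_beta')
  have iH: "integrable lborel (H w)" for w
    by (rule Bochner_Integration.integrable_bound[OF ff]) (use Hle Hm1 in \<open>auto\<close>)
  have normF: "(norm (F w))\<^sup>2 = (\<integral>p. H w p \<partial>lborel)" for w
  proof -
    have i: "integrable lborel (\<lambda>x. rot (x \<bullet> w) (f x))" by (rule fr) measurable
    have "(norm (F w))\<^sup>2 = (\<integral>x. rot (x \<bullet> w) (f x) \<bullet> F w \<partial>lborel)"
      unfolding power2_norm_eq_inner using integral_inner_left[OF i] by (simp add: F_def)
    also have "\<dots> = (\<integral>x. (\<integral>y. H w (x, y) \<partial>lborel) \<partial>lborel)"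
      using integral_inner_right[OF i] by (simp add: F_def H_def)
    also have "\<dots> = (\<integral>p. H w p \<partial>(lborel \<Otimes>\<^sub>M lborel))"
      by (rule lborel_pair.integral_fst') (simp add: lborel_prod iH)
    finally show ?thesis by (simp add: lborel_prod)
  qed
  have big: "integrable (lborel \<Otimes>\<^sub>M lborel) (\<lambda>(w::'a, p). gaussian (\<epsilon> *\<^sub>R w) * H w p)"
  proof (rule Bochner_Integration.integrable_bound[OF lborel_pair.integrable_tensor[OF gaussian_scaled(3)[OF e] ff]])
    show "(\<lambda>(w::'a, p). gaussian (\<epsilon> *\<^sub>R w) * H w p) \<in> borel_measurable (lborel \<Otimes>\<^sub>M lborel)"
      using Hm unfolding case_prod_beta' by measurable
    show "AE x in lborel \<Otimes>\<^sub>M lborel. norm (case x of (w, p) \<Rightarrow> gaussian (\<epsilon> *\<^sub>R w) * H w p)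
        \<le> norm (case x of (w, p) \<Rightarrow> gaussian (\<epsilon> *\<^sub>R w) * (norm (f (fst p)) * norm (f (snd p))))"
      using Hle by (intro AE_I2) (auto simp: abs_mult intro!: mult_left_mono)
  qed
  have energy: "gaussian (\<epsilon> *\<^sub>R w) * (norm (F w))\<^sup>2 = (\<integral>p. gaussian (\<epsilon> *\<^sub>R w) * H w p \<partial>lborel)" for w
    by (simp add: normF)
  show "integrable lborel (\<lambda>w. gaussian (\<epsilon> *\<^sub>R w) * (norm (F w))\<^sup>2)"
    unfolding energy by (rule lborel_pair.integrable_fst[OF big])
  define K where "K x y = (sqrt (2 * pi) / \<epsilon>) ^ DIM('a) * gaussian ((y - x) /\<^sub>R \<epsilon>) * (f x \<bullet> f y)" for x y
  have inner: "(\<integral>w. gaussian (\<epsilon> *\<^sub>R w) * H w (x, y) \<partial>lborel) = K x y" for x y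
  proof -
    have "gaussian (\<epsilon> *\<^sub>R w) * H w (x, y) = (cos ((y - x) \<bullet> w) * gaussian (\<epsilon> *\<^sub>R w)) * (f x \<bullet> f y)
        - (sin ((y - x) \<bullet> w) * gaussian (\<epsilon> *\<^sub>R w)) * (f x \<bullet> J (f y))" for w
      by (simp add: H_def inner_rot inner_diff_left algebra_simps)
    then show ?thesis
      using gaussian_scaled(1,2,4,5)[OF e, of "y - x"] by (simp add: K_def)
  qed
  have Kint: "integrable (lborel \<Otimes>\<^sub>M lborel) (\<lambda>(x, y). K x y)"
    using lborel_pair.integrable_snd[OF big] by (simp add: lborel_prod inner[symmetric] case_prod_beta')
  have subst: "(\<integral>y. K x y \<partial>lborel)
      = (\<integral>u. sqrt (2 * pi) ^ DIM('a) * gaussian u * (f x \<bullet> f (x + \<epsilon> *\<^sub>R u)) \<partial>lborel)" for x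
  proof -
    have "\<epsilon> ^ DIM('a) * K x (x + \<epsilon> *\<^sub>R u) = sqrt (2 * pi) ^ DIM('a) * gaussian u * (f x \<bullet> f (x + \<epsilon> *\<^sub>R u))" for u
      using e by (simp add: K_def power_divide)
    moreover have "K x \<in> borel_measurable borel" unfolding K_def by measurable
    from integral_lborel_affine[OF this e, of x]
    have "(\<integral>y. K x y \<partial>lborel) = (\<integral>u. \<epsilon> ^ DIM('a) * K x (x + \<epsilon> *\<^sub>R u) \<partial>lborel)"
      by simp
    ultimately show ?thesis by simp
  qed
  note sh2 = sq_integrable_lborel_shift[OF f2] and shn = l2norm_lborel_shift[OF f2]
  define k where "k u = sqrt (2 * pi) ^ DIM('a) * gaussian (u :: 'a)" for u
  have k0: "0 \<le> k u" for u by (simp add: k_def)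
  have [measurable]: "k \<in> borel_measurable borel" unfolding k_def by measurable
  have ik: "integrable lborel k" unfolding k_def using integrable_gaussian by auto
  have swap: "integrable (lborel \<Otimes>\<^sub>M lborel) (\<lambda>(u, x). k u * (f x \<bullet> f (x + \<epsilon> *\<^sub>R u)))"
  proof (rule lborel_pair.Fubini_integrable)
    show "(\<lambda>(u, x). k u * (f x \<bullet> f (x + \<epsilon> *\<^sub>R u))) \<in> borel_measurable (lborel \<Otimes>\<^sub>M lborel)"
      by measurable
    show "AE u in lborel. integrable lborel (\<lambda>x. case (u, x) of (u, x) \<Rightarrow> k u * (f x \<bullet> f (x + \<epsilon> *\<^sub>R u)))"
      using integrable_inner[OF f2 sh2] by simp
    show "integrable lborel (\<lambda>u. \<integral>x. norm (case (u, x) of (u, x) \<Rightarrow> k u * (f x \<bullet> f (x + \<epsilon> *\<^sub>R u))) \<partial>lborel)"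
    proof (rule Bochner_Integration.integrable_bound)
      show "integrable lborel (\<lambda>u. k u * (l2norm lborel f)\<^sup>2)" using ik by simp
      show "(\<lambda>u. \<integral>x. norm (case (u, x) of (u, x) \<Rightarrow> k u * (f x \<bullet> f (x + \<epsilon> *\<^sub>R u))) \<partial>lborel)
          \<in> borel_measurable lborel" by measurable
      have "(\<integral>x. \<bar>f x \<bullet> f (x + \<epsilon> *\<^sub>R u)\<bar> \<partial>lborel) \<le> (l2norm lborel f)\<^sup>2" for u
      proof -
        have "(\<integral>x. \<bar>f x \<bullet> f (x + \<epsilon> *\<^sub>R u)\<bar> \<partial>lborel) \<le> (\<integral>x. norm (f x) * norm (f (x + \<epsilon> *\<^sub>R u)) \<partial>lborel)"
          using integrable_inner[OF f2 sh2] integrable_norm_mult[OF f2 sh2]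
          by (intro integral_mono) (auto simp: Cauchy_Schwarz_ineq2)
        also have "\<dots> \<le> l2norm lborel f * l2norm lborel f"
          using Cauchy_Schwarz_l2norm[OF f2 sh2] by (simp add: shn)
        finally show ?thesis by (simp add: power2_eq_square)
      qed
      then show "AE u in lborel. norm (\<integral>x. norm (case (u, x) of (u, x) \<Rightarrow> k u * (f x \<bullet> f (x + \<epsilon> *\<^sub>R u))) \<partial>lborel)
          \<le> norm (k u * (l2norm lborel f)\<^sup>2)"
        using k0 by (auto simp: abs_mult intro!: mult_left_mono)
    qed
  qed
  have "(\<integral>w. gaussian (\<epsilon> *\<^sub>R w) * (norm (F w))\<^sup>2 \<partial>lborel)
      = (\<integral>w. (\<integral>p. gaussian (\<epsilon> *\<^sub>R w) * H w p \<partial>lborel) \<partial>lborel)"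
    by (simp only: energy)
  also have "\<dots> = (\<integral>p. (\<integral>w. gaussian (\<epsilon> *\<^sub>R w) * H w p \<partial>lborel) \<partial>lborel)"
    by (rule lborel_pair.Fubini_integral[OF big, symmetric])
  also have "\<dots> = (\<integral>p. (case p of (x, y) \<Rightarrow> K x y) \<partial>(lborel \<Otimes>\<^sub>M lborel))"
    by (simp add: lborel_prod inner[symmetric] split_beta)
  also have "\<dots> = (\<integral>x. (\<integral>y. K x y \<partial>lborel) \<partial>lborel)"
    using lborel_pair.integral_fst[OF Kint] by simp
  also have "\<dots> = (\<integral>x. (\<integral>u. k u * (f x \<bullet> f (x + \<epsilon> *\<^sub>R u)) \<partial>lborel) \<partial>lborel)"
    unfolding subst k_def ..
  also have "\<dots> = (\<integral>u. (\<integral>x. k u * (f x \<bullet> f (x + \<epsilon> *\<^sub>R u)) \<partial>lborel) \<partial>lborel)"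
    by (rule lborel_pair.Fubini_integral[OF swap])
  finally show "(\<integral>w. gaussian (\<epsilon> *\<^sub>R w) * (norm (F w))\<^sup>2 \<partial>lborel)
      = (\<integral>u. sqrt (2 * pi) ^ DIM('a) * gaussian u * (\<integral>x. f x \<bullet> f (x + \<epsilon> *\<^sub>R u) \<partial>lborel) \<partial>lborel)"
    by (simp add: k_def)
qed

text \<open>
  Let \<open>\<epsilon>\<close> decrease to \<open>0\<close> in the regularised energy.  Its autocorrelation form converges by
  dominated convergence, the bound being \<open>\<bar>R\<bar> \<le> \<parallel>f\<parallel>\<^sup>2\<close>; the energies themselves increase, so monotone
  convergence shows that \<open>\<bar>F\<bar>\<^sup>2\<close> is integrable and identifies its integral.
\<close>

lemma plancherel_borel:
  fixes f :: "'a::euclidean_space \<Rightarrow> 'v"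
  assumes f1: "integrable lborel f" and f2: "sq_integrable lborel f"
  defines "F \<equiv> (\<lambda>w. \<integral>x. rot (x \<bullet> w) (f x) \<partial>lborel)"
  shows "sq_integrable lborel F"
    and "(l2norm lborel F)\<^sup>2 = (2 * pi) ^ DIM('a) * (l2norm lborel f)\<^sup>2"
proof -
  have [measurable]: "f \<in> borel_measurable borel" using f1 by auto
  have [measurable]: "F \<in> borel_measurable borel"
    unfolding F_def by measurable
  define \<epsilon> where "\<epsilon> n = 1 / real (Suc n)" for n
  have e0: "0 < \<epsilon> n" for n by (simp add: \<epsilon>_def)
  have elim: "\<epsilon> \<longlonglongrightarrow> 0" unfolding \<epsilon>_def using LIMSEQ_inverse_real_of_nat by (simp add: inverse_eq_divide)
  define G where "G n w = gaussian (\<epsilon> n *\<^sub>R w) * (norm (F w))\<^sup>2" for n and w :: 'a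
  define R where "R z = (\<integral>x. f x \<bullet> f (x + z) \<partial>lborel)" for z
  have iG: "integrable lborel (G n)" for n
    unfolding G_def F_def by (rule gaussian_regularised_energy(1)[OF f1 f2 e0])
  have GR: "(\<integral>w. G n w \<partial>lborel) = (\<integral>u. sqrt (2 * pi) ^ DIM('a) * gaussian u * R (\<epsilon> n *\<^sub>R u) \<partial>lborel)" for n
    unfolding G_def F_def R_def by (rule gaussian_regularised_energy(2)[OF f1 f2 e0])
  have [measurable]: "R \<in> borel_measurable borel" unfolding R_def by measurable
  have R0: "R 0 = (l2norm lborel f)\<^sup>2" by (simp add: R_def l2norm_power2 power2_norm_eq_inner)
  note sh2 = sq_integrable_lborel_shift[OF f2] and shn = l2norm_lborel_shift[OF f2]
  have Rle: "\<bar>R z\<bar> \<le> (l2norm lborel f)\<^sup>2" for z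
    using abs_integral_inner_le[OF f2 sh2[of z]] by (simp add: R_def shn power2_eq_square)
  have "(\<lambda>n. \<integral>u. sqrt (2 * pi) ^ DIM('a) * gaussian u * R (\<epsilon> n *\<^sub>R u) \<partial>lborel)
      \<longlonglongrightarrow> (\<integral>u. sqrt (2 * pi) ^ DIM('a) * gaussian (u::'a) * R 0 \<partial>lborel)"
  proof (rule integral_dominated_convergence[where w = "\<lambda>u. sqrt (2 * pi) ^ DIM('a) * gaussian u * (l2norm lborel f)\<^sup>2"])
    show "integrable lborel (\<lambda>u::'a. sqrt (2 * pi) ^ DIM('a) * gaussian u * (l2norm lborel f)\<^sup>2)"
      using integrable_gaussian by auto
    show "AE u in lborel. (\<lambda>n. sqrt (2 * pi) ^ DIM('a) * gaussian u * R (\<epsilon> n *\<^sub>R u))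
        \<longlonglongrightarrow> sqrt (2 * pi) ^ DIM('a) * gaussian (u::'a) * R 0"
    proof (rule AE_I2)
      fix u :: 'a
      have "(\<lambda>n. \<epsilon> n *\<^sub>R u) \<longlonglongrightarrow> 0 *\<^sub>R u" by (intro tendsto_intros elim)
      then have "(\<lambda>n. R (\<epsilon> n *\<^sub>R u)) \<longlonglongrightarrow> R 0"
        unfolding R_def using autocorrelation_tendsto[OF f1 f2, of "\<lambda>n. \<epsilon> n *\<^sub>R u"] by simp
      then show "(\<lambda>n. sqrt (2 * pi) ^ DIM('a) * gaussian u * R (\<epsilon> n *\<^sub>R u))
        \<longlonglongrightarrow> sqrt (2 * pi) ^ DIM('a) * gaussian u * R 0" by (intro tendsto_intros)
    qed
    show "AE u in lborel. norm (sqrt (2 * pi) ^ DIM('a) * gaussian u * R (\<epsilon> n *\<^sub>R u))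
       \<le> sqrt (2 * pi) ^ DIM('a) * gaussian (u::'a) * (l2norm lborel f)\<^sup>2" for n
      using Rle by (auto simp: abs_mult intro!: mult_left_mono)
  qed measurable
  also have "(\<integral>u. sqrt (2 * pi) ^ DIM('a) * gaussian (u::'a) * R 0 \<partial>lborel)
      = (2 * pi) ^ DIM('a) * (l2norm lborel f)\<^sup>2"
  proof -
    have "sqrt (2 * pi) ^ DIM('a) * sqrt (2 * pi) ^ DIM('a) = (2 * pi) ^ DIM('a)"
      by (simp only: power_mult_distrib[symmetric] real_sqrt_mult_self) simp
    then show ?thesis by (simp add: integral_gaussian R0)
  qed
  finally have Glim: "(\<lambda>n. \<integral>w. G n w \<partial>lborel) \<longlonglongrightarrow> (2 * pi) ^ DIM('a) * (l2norm lborel f)\<^sup>2"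
    by (simp only: GR)
  have mono: "AE w in lborel. mono (\<lambda>n. G n w)"
  proof (rule AE_I2, rule monoI)
    fix w :: 'a and m n :: nat assume "m \<le> n"
    then have "\<epsilon> n \<le> \<epsilon> m" by (simp add: \<epsilon>_def frac_le)
    then have "(\<epsilon> n * norm w)\<^sup>2 \<le> (\<epsilon> m * norm w)\<^sup>2"
      using e0[of n] by (intro power_mono mult_right_mono) auto
    then show "G m w \<le> G n w"
      using e0 by (auto simp: G_def gaussian_def abs_of_pos intro!: mult_right_mono)
  qed
  have lim: "AE w in lborel. (\<lambda>n. G n w) \<longlonglongrightarrow> (norm (F w))\<^sup>2"
  proof (rule AE_I2)
    fix w :: 'a
    have "(\<lambda>n. exp (- (norm (\<epsilon> n *\<^sub>R w))\<^sup>2 / 2) * (norm (F w))\<^sup>2)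
        \<longlonglongrightarrow> exp (- (norm (0 *\<^sub>R w))\<^sup>2 / 2) * (norm (F w))\<^sup>2"
      by (intro tendsto_intros elim) auto
    then show "(\<lambda>n. G n w) \<longlonglongrightarrow> (norm (F w))\<^sup>2" by (simp add: G_def gaussian_def)
  qed
  have Fm: "(\<lambda>w. (norm (F w))\<^sup>2) \<in> borel_measurable lborel" by measurable
  show "sq_integrable lborel F"
    unfolding sq_integrable_def using integrable_monotone_convergence[OF iG mono lim Glim Fm] by simp
  show "(l2norm lborel F)\<^sup>2 = (2 * pi) ^ DIM('a) * (l2norm lborel f)\<^sup>2"
    unfolding l2norm_power2[of _ F] using integral_monotone_convergence[OF iG mono lim Glim Fm] by simp
qed

end

section \<open>Extension of the transform to square integrable functions\<close>

lemma lebesgue_shift: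
  fixes f :: "'a::euclidean_space \<Rightarrow> 'b::{banach, second_countable_topology}"
  assumes f: "f \<in> borel_measurable lebesgue"
  shows measurable_lebesgue_shift: "(\<lambda>x. f (x + t)) \<in> borel_measurable lebesgue"
    and integrable_lebesgue_shift: "integrable lebesgue (\<lambda>x. f (x + t)) \<longleftrightarrow> integrable lebesgue f"
    and integral_lebesgue_shift: "(\<integral>x. f (x + t) \<partial>lebesgue) = (\<integral>x. f x \<partial>lebesgue)"
proof -
  have T: "(\<lambda>x. t + (\<Sum>j\<in>Basis. (1 * (x \<bullet> j)) *\<^sub>R j)) = (\<lambda>x. x + t)"
    by (simp add: euclidean_representation add.commute)
  have m: "(\<lambda>x. x + t) \<in> lebesgue \<rightarrow>\<^sub>M lebesgue"
    using lebesgue_affine_measurable[of "\<lambda>_::'a. 1" t] unfolding T by simp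
  have d: "distr lebesgue lebesgue (\<lambda>x. x + t) = lebesgue"
    using lebesgue_affine_euclidean[of "\<lambda>_::'a. 1" t] unfolding T by (simp add: density_1)
  show "(\<lambda>x. f (x + t)) \<in> borel_measurable lebesgue"
    using measurable_compose[OF m f] .
  show "integrable lebesgue (\<lambda>x. f (x + t)) \<longleftrightarrow> integrable lebesgue f"
    using integrable_distr_eq[OF m f] by (simp add: d)
  show "(\<integral>x. f (x + t) \<partial>lebesgue) = (\<integral>x. f x \<partial>lebesgue)"
    using integral_distr[OF m f] by (simp add: d)
qed

lemma sq_integrable_shift:
  fixes f :: "'a::euclidean_space \<Rightarrow> 'b::euclidean_space"
  assumes "sq_integrable lebesgue f"
  shows "sq_integrable lebesgue (\<lambda>x. f (x + t))"
    and "l2norm lebesgue (\<lambda>x. f (x + t)) = l2norm lebesgue f"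
proof -
  have m: "f \<in> borel_measurable lebesgue" "(\<lambda>x. (norm (f x))\<^sup>2) \<in> borel_measurable lebesgue"
    using assms by (auto simp: sq_integrable_def)
  show "sq_integrable lebesgue (\<lambda>x. f (x + t))"
    using assms measurable_lebesgue_shift[OF m(1)] integrable_lebesgue_shift[OF m(2)]
    by (simp add: sq_integrable_def)
  show "l2norm lebesgue (\<lambda>x. f (x + t)) = l2norm lebesgue f"
    using integral_lebesgue_shift[OF m(2), of t] by (simp add: l2norm_def)
qed

lemma measurable_inner_lebesgue [measurable]:
  fixes w :: "'a::euclidean_space"
  shows "(\<lambda>x. x \<bullet> w) \<in> borel_measurable lebesgue" "(\<lambda>x. w \<bullet> x) \<in> borel_measurable lebesgue"
  by (auto intro!: measurable_completion)

text \<open>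
  Fubini's theorem works on products of \<^const>\<open>lborel\<close>, whereas the transform is defined on the
  completed measure; Borel representatives connect the two.
\<close>

lemma lebesgue_ex_borel:
  fixes f :: "'a::euclidean_space \<Rightarrow> 'b::euclidean_space"
  assumes "f \<in> borel_measurable lebesgue"
  obtains f' where "f' \<in> borel_measurable borel" "AE x in lebesgue. f x = f' x"
proof -
  have "\<exists>g\<in>borel_measurable lborel. AE x in lborel. f x \<bullet> b = g x" for b
    by (rule completion_ex_borel_measurable_real) (use assms in measurable)
  then obtain g where g: "\<And>b. g b \<in> borel_measurable lborel" "\<And>b. AE x in lborel. f x \<bullet> b = g b x"
    by metis
  have "AE x in lborel. \<forall>b\<in>Basis. f x \<bullet> b = g b x"
    using g(2) by (intro AE_finite_allI) auto
  then have "AE x in lborel. f x = (\<Sum>b\<in>Basis. g b x *\<^sub>R b)"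
  proof eventually_elim
    case (elim x)
    have "f x = (\<Sum>b\<in>Basis. (f x \<bullet> b) *\<^sub>R b)" by (simp add: euclidean_representation)
    also have "\<dots> = (\<Sum>b\<in>Basis. g b x *\<^sub>R b)" using elim by (intro sum.cong) auto
    finally show ?case .
  qed
  then have "AE x in lebesgue. f x = (\<Sum>b\<in>Basis. g b x *\<^sub>R b)" by (rule AE_completion)
  moreover have "(\<lambda>x. \<Sum>b\<in>Basis. g b x *\<^sub>R b) \<in> borel_measurable borel"
    using g(1) by measurable
  ultimately show thesis using that by blast
qed

lemma sq_integrable_cong_AE:
  assumes "AE x in M. f x = g x" "f \<in> borel_measurable M" "g \<in> borel_measurable M"
  shows "sq_integrable M f \<longleftrightarrow> sq_integrable M g" "l2norm M f = l2norm M g"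
proof -
  have "integrable M (\<lambda>x. (norm (f x))\<^sup>2) \<longleftrightarrow> integrable M (\<lambda>x. (norm (g x))\<^sup>2)"
    by (rule integrable_cong_AE) (use assms in auto)
  then show "sq_integrable M f \<longleftrightarrow> sq_integrable M g"
    using assms(2,3) by (simp add: sq_integrable_def)
  have "(\<integral>x. (norm (f x))\<^sup>2 \<partial>M) = (\<integral>x. (norm (g x))\<^sup>2 \<partial>M)"
    by (rule integral_cong_AE) (use assms in auto)
  then show "l2norm M f = l2norm M g" by (simp add: l2norm_def)
qed

lemma sq_integrable_restrict_integrable:
  assumes f: "sq_integrable M f" and S: "S \<in> sets M" "emeasure M S < \<infinity>"
  shows "integrable M (\<lambda>x. indicat_real S x *\<^sub>R f x)"
    and "sq_integrable M (\<lambda>x. indicat_real S x *\<^sub>R f x)"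
proof -
  have [measurable]: "f \<in> borel_measurable M" "S \<in> sets M" using f S by (auto simp: sq_integrable_def)
  have i: "integrable M (\<lambda>x. indicat_real S x + (norm (f x))\<^sup>2)"
    using f S by (auto simp: sq_integrable_def integrable_indicator_iff less_top)
  have le: "norm (indicat_real S x *\<^sub>R f x) \<le> norm (indicat_real S x + (norm (f x))\<^sup>2)" for x
  proof -
    have "norm (f x) \<le> 1 + (norm (f x))\<^sup>2"
      using sum_squares_bound[of 1 "norm (f x)"] norm_ge_zero[of "f x"] unfolding power_one by linarith
    then show ?thesis by (auto simp: indicator_def)
  qed
  show "integrable M (\<lambda>x. indicat_real S x *\<^sub>R f x)"
    by (rule Bochner_Integration.integrable_bound[OF i _ AE_I2[OF le]]) measurable
  show "sq_integrable M (\<lambda>x. indicat_real S x *\<^sub>R f x)"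
    by (rule sq_integrable_bound[OF f, of _ 1]) (auto simp: indicator_def)
qed

context orthogonal_complex_structure
begin

theorem plancherel:
  fixes f :: "'a::euclidean_space \<Rightarrow> 'v"
  assumes f1: "integrable lebesgue f" and f2: "sq_integrable lebesgue f"
  shows "sq_integrable lebesgue (fourier f)"
    and "l2norm lebesgue (fourier f) = sqrt ((2 * pi) ^ DIM('a)) * l2norm lebesgue f"
proof -
  have fm: "f \<in> borel_measurable lebesgue" using f1 by auto
  then obtain f' where f'[measurable]: "f' \<in> borel_measurable borel" and ae: "AE x in lebesgue. f x = f' x"
    using lebesgue_ex_borel by blast
  have f'm: "f' \<in> borel_measurable lebesgue" using f' by (simp add: measurable_completion)
  have "integrable lebesgue f'"
    using integrable_cong_AE[OF fm f'm ae] f1 by simp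
  then have f'1: "integrable lborel f'" by (simp add: integrable_completion)
  have "sq_integrable lebesgue f'" using sq_integrable_cong_AE(1)[OF ae fm f'm] f2 by simp
  then have f'2: "sq_integrable lborel f'"
    by (simp add: sq_integrable_def integrable_completion)
  have l2: "l2norm lebesgue k = l2norm lborel k" if [measurable]: "k \<in> borel_measurable borel" for k :: "'a \<Rightarrow> 'v"
    by (simp add: l2norm_def integral_completion)
  have F: "fourier f = (\<lambda>w. \<integral>x. rot (x \<bullet> w) (f' x) \<partial>lborel)"
  proof
    fix w :: 'a
    note m = measurable_inner_lebesgue(1)[of w]
    have "fourier f w = (\<integral>x. rot (x \<bullet> w) (f' x) \<partial>lebesgue)"
      unfolding fourier_def
      by (rule integral_cong_AE)
         (use ae measurable_rot[OF m fm] measurable_rot[OF m f'm] in auto)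
    then show "fourier f w = (\<integral>x. rot (x \<bullet> w) (f' x) \<partial>lborel)"
      by (simp add: integral_completion)
  qed
  note P = plancherel_borel[OF f'1 f'2, folded F]
  have [measurable]: "fourier f \<in> borel_measurable borel" using P(1) by (simp add: sq_integrable_def)
  show "sq_integrable lebesgue (fourier f)"
    using P(1) by (auto simp: sq_integrable_def integrable_completion intro!: measurable_completion)
  have "l2norm lebesgue (fourier f) = sqrt ((2 * pi) ^ DIM('a) * (l2norm lborel f')\<^sup>2)"
    unfolding P(2)[symmetric] by (simp add: l2)
  also have "l2norm lborel f' = l2norm lebesgue f"
    using sq_integrable_cong_AE(2)[OF ae fm f'm] by (simp add: l2)
  finally show "l2norm lebesgue (fourier f) = sqrt ((2 * pi) ^ DIM('a)) * l2norm lebesgue f"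
    by (simp add: real_sqrt_mult)
qed

lemma integrable_fourier:
  fixes f :: "'a::euclidean_space \<Rightarrow> 'v"
  assumes "integrable lebesgue f"
  shows "integrable lebesgue (\<lambda>x. rot (x \<bullet> w) (f x))"
  by (rule integrable_rot[OF assms measurable_inner_lebesgue(1)])

lemma fourier_diff:
  fixes f g :: "'a::euclidean_space \<Rightarrow> 'v"
  assumes "integrable lebesgue f" "integrable lebesgue g"
  shows "fourier (\<lambda>x. f x - g x) w = fourier f w - fourier g w"
  using integrable_fourier[OF assms(1)] integrable_fourier[OF assms(2)]
  by (simp add: fourier_def linear_diff[OF linear_rot])

lemma fourier_shift:
  fixes f :: "'a::euclidean_space \<Rightarrow> 'v"
  assumes f: "integrable lebesgue f"
  shows "fourier (\<lambda>x. f (x + s)) w = rot (- (s \<bullet> w)) (fourier f w)"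
proof -
  have eq: "rot (x \<bullet> w) (f (x + s)) = rot (- (s \<bullet> w)) (rot ((x + s) \<bullet> w) (f (x + s)))" for x
    by (simp add: rot_add inner_add_left)
  have i: "integrable lebesgue (\<lambda>x. rot (x \<bullet> w) (f x))" by (rule integrable_fourier[OF f])
  then have m: "(\<lambda>x. rot (- (s \<bullet> w)) (rot (x \<bullet> w) (f x))) \<in> borel_measurable lebesgue"
    by (intro measurable_rot[OF _ borel_measurable_integrable]) auto
  have "fourier (\<lambda>x. f (x + s)) w = (\<integral>x. rot (- (s \<bullet> w)) (rot (x \<bullet> w) (f x)) \<partial>lebesgue)"
    unfolding fourier_def eq using integral_lebesgue_shift[OF m, of s] by simp
  also have "\<dots> = rot (- (s \<bullet> w)) (fourier f w)"
    unfolding fourier_def by (rule integral_bounded_linear[OF bounded_linear_rot i])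
  finally show ?thesis .
qed

text \<open>
  This determines \<open>g\<close> up to a null set, since every square integrable \<open>f\<close> is the limit of functions
  in \<open>L\<^sup>1 \<inter> L\<^sup>2\<close>.
\<close>

definition fourier_L2 :: "('a::euclidean_space \<Rightarrow> 'v) \<Rightarrow> ('a \<Rightarrow> 'v) \<Rightarrow> bool" where
  "fourier_L2 f g \<longleftrightarrow> sq_integrable lebesgue g \<and>
    (\<forall>h. (\<forall>k. integrable lebesgue (h k) \<and> sq_integrable lebesgue (h k)) \<longrightarrow>
       (\<lambda>k. l2norm lebesgue (\<lambda>x. h k x - f x)) \<longlonglongrightarrow> 0 \<longrightarrow>
       (\<lambda>k. l2norm lebesgue (\<lambda>w. fourier (h k) w - g w)) \<longlonglongrightarrow> 0)"

lemma ex_L1_L2_approximation: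
  fixes f :: "'a::euclidean_space \<Rightarrow> 'v"
  assumes f: "sq_integrable lebesgue f"
  obtains h where "\<And>k::nat. integrable lebesgue (h k)" "\<And>k. sq_integrable lebesgue (h k)"
    "(\<lambda>k. l2norm lebesgue (\<lambda>x. h k x - f x)) \<longlonglongrightarrow> 0"
proof
  let ?B = "\<lambda>k::nat. cball (0::'a) (real k)"
  have B: "?B k \<in> sets lebesgue" "emeasure lebesgue (?B k) < \<infinity>" for k
    using emeasure_lborel_cball_finite[of 0 "real k"] by auto
  show "integrable lebesgue (\<lambda>x. indicat_real (?B k) x *\<^sub>R f x)"
    and "sq_integrable lebesgue (\<lambda>x. indicat_real (?B k) x *\<^sub>R f x)" for k
    using sq_integrable_restrict_integrable[OF f B] by auto
  show "(\<lambda>k. l2norm lebesgue (\<lambda>x. indicat_real (?B k) x *\<^sub>R f x - f x)) \<longlonglongrightarrow> 0"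
  proof (rule l2norm_restrict_tendsto[OF f B(1)])
    fix x :: 'a
    obtain N where "norm x \<le> real N" using real_arch_simple by blast
    then show "eventually (\<lambda>k. x \<in> ?B k) sequentially"
      by (intro eventually_sequentiallyI[of N]) auto
  qed
qed

lemma l2norm_fourier_diff:
  fixes f g :: "'a::euclidean_space \<Rightarrow> 'v"
  assumes "integrable lebesgue f" "sq_integrable lebesgue f" "integrable lebesgue g" "sq_integrable lebesgue g"
  shows "l2norm lebesgue (\<lambda>w. fourier f w - fourier g w)
    = sqrt ((2 * pi) ^ DIM('a)) * l2norm lebesgue (\<lambda>x. f x - g x)"
proof -
  have "fourier (\<lambda>x. f x - g x) = (\<lambda>w. fourier f w - fourier g w)"
    by (rule ext) (rule fourier_diff[OF assms(1,3)])
  then show ?thesis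
    using plancherel(2)[OF Bochner_Integration.integrable_diff[OF assms(1,3)] sq_integrable_diff[OF assms(2,4)]]
    by (simp only:)
qed

text \<open>
  By Plancherel's identity the transforms of one approximating sequence \<open>h\<close> form a Cauchy sequence, and the
  transforms of any other approximating sequence have the same limit.
\<close>

theorem ex_fourier_L2:
  fixes f :: "'a::euclidean_space \<Rightarrow> 'v"
  assumes f: "sq_integrable lebesgue f"
  shows "\<exists>g. fourier_L2 f g"
proof -
  let ?c = "sqrt ((2 * pi) ^ DIM('a))"
  have c: "0 < ?c" by simp
  obtain h where h1: "\<And>k::nat. integrable lebesgue (h k)" and h2: "\<And>k. sq_integrable lebesgue (h k)"
    and hf: "(\<lambda>k. l2norm lebesgue (\<lambda>x. h k x - f x)) \<longlonglongrightarrow> 0"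
    using ex_L1_L2_approximation[OF f] by blast
  have F2: "sq_integrable lebesgue (fourier (h k))" for k by (rule plancherel(1)[OF h1 h2])
  obtain g where g: "sq_integrable lebesgue g"
    and Fg: "(\<lambda>k. l2norm lebesgue (\<lambda>w. fourier (h k) w - g w)) \<longlonglongrightarrow> 0"
  proof (rule l2_complete[OF F2])
    fix e :: real assume "0 < e"
    then have "0 < e / (2 * ?c)" using c by (intro divide_pos_pos) auto
    from LIMSEQ_D[OF hf this] obtain N
      where N: "\<And>n. n \<ge> N \<Longrightarrow> l2norm lebesgue (\<lambda>x. h n x - f x) < e / (2 * ?c)"
      by auto
    show "\<exists>N. \<forall>m\<ge>N. \<forall>n\<ge>N. l2norm lebesgue (\<lambda>w. fourier (h m) w - fourier (h n) w) < e"
    proof (intro exI[of _ N] allI impI)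
      fix m n assume "N \<le> m" "N \<le> n"
      have "l2norm lebesgue (\<lambda>x. h m x - h n x)
          \<le> l2norm lebesgue (\<lambda>x. h m x - f x) + l2norm lebesgue (\<lambda>x. h n x - f x)"
        using l2norm_diff_triangle[OF h2 f h2, of m n] by (simp only: l2norm_minus_commute[of _ f])
      also have "\<dots> < e / (2 * ?c) + e / (2 * ?c)"
        using N[OF \<open>N \<le> m\<close>] N[OF \<open>N \<le> n\<close>] by (rule add_strict_mono)
      also have "\<dots> = e / ?c" by simp
      finally have "?c * l2norm lebesgue (\<lambda>x. h m x - h n x) < ?c * (e / ?c)"
        using c by (rule mult_strict_left_mono)
      then show "l2norm lebesgue (\<lambda>w. fourier (h m) w - fourier (h n) w) < e"
        unfolding l2norm_fourier_diff[OF h1 h2 h1 h2] using c by simp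
    qed
  qed blast
  have "fourier_L2 f g"
    unfolding fourier_L2_def
  proof (intro conjI allI impI g)
    fix k :: "nat \<Rightarrow> 'a \<Rightarrow> 'v"
    assume "\<forall>j. integrable lebesgue (k j) \<and> sq_integrable lebesgue (k j)"
    then have k1: "\<And>j. integrable lebesgue (k j)" and k2: "\<And>j. sq_integrable lebesgue (k j)" by auto
    assume kf: "(\<lambda>j. l2norm lebesgue (\<lambda>x. k j x - f x)) \<longlonglongrightarrow> 0"
    have le: "l2norm lebesgue (\<lambda>w. fourier (k j) w - g w)
      \<le> ?c * (l2norm lebesgue (\<lambda>x. k j x - f x) + l2norm lebesgue (\<lambda>x. h j x - f x))
        + l2norm lebesgue (\<lambda>w. fourier (h j) w - g w)" for j
    proof -
      have "l2norm lebesgue (\<lambda>w. fourier (k j) w - g w)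
        \<le> l2norm lebesgue (\<lambda>w. fourier (k j) w - fourier (h j) w) + l2norm lebesgue (\<lambda>w. fourier (h j) w - g w)"
        by (rule l2norm_diff_triangle[OF plancherel(1)[OF k1 k2] F2 g])
      moreover have "l2norm lebesgue (\<lambda>x. k j x - h j x)
        \<le> l2norm lebesgue (\<lambda>x. k j x - f x) + l2norm lebesgue (\<lambda>x. h j x - f x)"
        using l2norm_diff_triangle[OF k2 f h2, of j j] by (simp only: l2norm_minus_commute[of _ f])
      then have "?c * l2norm lebesgue (\<lambda>x. k j x - h j x)
        \<le> ?c * (l2norm lebesgue (\<lambda>x. k j x - f x) + l2norm lebesgue (\<lambda>x. h j x - f x))"
        using c by (intro mult_left_mono) auto
      ultimately show ?thesis
        unfolding l2norm_fourier_diff[OF k1 k2 h1 h2] by linarith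
    qed
    have lim: "(\<lambda>j. ?c * (l2norm lebesgue (\<lambda>x. k j x - f x) + l2norm lebesgue (\<lambda>x. h j x - f x))
        + l2norm lebesgue (\<lambda>w. fourier (h j) w - g w)) \<longlonglongrightarrow> ?c * (0 + 0) + 0"
      by (intro tendsto_intros kf hf Fg)
    show "(\<lambda>j. l2norm lebesgue (\<lambda>w. fourier (k j) w - g w)) \<longlonglongrightarrow> 0"
      by (rule Lim_null_comparison[OF always_eventually lim[simplified]]) (use le in simp)
  qed
  then show ?thesis by blast
qed

lemma l2norm_fourier_limit:
  fixes f g :: "'a::euclidean_space \<Rightarrow> 'v"
  assumes f: "sq_integrable lebesgue f" and g: "sq_integrable lebesgue g"
    and h1: "\<And>k::nat. integrable lebesgue (h k)" and h2: "\<And>k. sq_integrable lebesgue (h k)"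
    and hf: "(\<lambda>k. l2norm lebesgue (\<lambda>x. h k x - f x)) \<longlonglongrightarrow> 0"
    and hg: "(\<lambda>k. l2norm lebesgue (\<lambda>w. fourier (h k) w - g w)) \<longlonglongrightarrow> 0"
  shows "l2norm lebesgue g = sqrt ((2 * pi) ^ DIM('a)) * l2norm lebesgue f"
proof (rule LIMSEQ_unique)
  show "(\<lambda>k. l2norm lebesgue (fourier (h k))) \<longlonglongrightarrow> l2norm lebesgue g"
    by (rule l2norm_tendsto[OF plancherel(1)[OF h1 h2] g hg])
  show "(\<lambda>k. l2norm lebesgue (fourier (h k))) \<longlonglongrightarrow> sqrt ((2 * pi) ^ DIM('a)) * l2norm lebesgue f"
    unfolding plancherel(2)[OF h1 h2] by (intro tendsto_mult tendsto_const l2norm_tendsto[OF h2 f hf])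
qed

section \<open>The uncertainty inequality\<close>

lemma norm_rot_diff_le: "norm (rot \<theta> v - v) \<le> \<bar>\<theta>\<bar> * norm v"
proof (rule power2_le_imp_le)
  have vJ: "v \<bullet> J v = 0" using J_skew[of v v] by (simp add: inner_commute)
  have "(norm (rot \<theta> v - v))\<^sup>2 = (norm (rot \<theta> v))\<^sup>2 + (norm v)\<^sup>2 - 2 * (rot \<theta> v \<bullet> v)"
    by (simp add: power2_norm_eq_inner inner_diff_left inner_diff_right inner_commute)
  also have "rot \<theta> v \<bullet> v = cos \<theta> * (norm v)\<^sup>2"
    using inner_rot[of \<theta> v 0 v] by (simp add: vJ power2_norm_eq_inner) (simp add: rot_def)
  also have "(norm (rot \<theta> v))\<^sup>2 + (norm v)\<^sup>2 - 2 * (cos \<theta> * (norm v)\<^sup>2) = 4 * (sin (\<theta> / 2))\<^sup>2 * (norm v)\<^sup>2"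
  proof -
    have "cos \<theta> = 1 - 2 * (sin (\<theta> / 2))\<^sup>2" using cos_double_sin[of "\<theta> / 2"] by simp
    then show ?thesis by (simp only: norm_rot) (simp add: algebra_simps)
  qed
  also have "\<dots> \<le> \<theta>\<^sup>2 * (norm v)\<^sup>2"
  proof (rule mult_right_mono)
    have "\<bar>sin (\<theta> / 2)\<bar> \<le> \<bar>\<theta> / 2\<bar>" by (rule abs_sin_x_le_abs_x)
    then have "(sin (\<theta> / 2))\<^sup>2 \<le> (\<theta> / 2)\<^sup>2" by (simp only: abs_le_square_iff)
    then show "4 * (sin (\<theta> / 2))\<^sup>2 \<le> \<theta>\<^sup>2" by (simp add: power_divide)
  qed simp
  finally show "(norm (rot \<theta> v - v))\<^sup>2 \<le> (\<bar>\<theta>\<bar> * norm v)\<^sup>2" by (simp add: power_mult_distrib)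
qed simp

text \<open>
  The transform of \<open>x \<mapsto> f (x + s) - f x\<close> is \<open>w \<mapsto> rot (- (s \<cdot> w)) (g w) - g w\<close>, whose norm is at most
  \<open>\<bar>s \<cdot> w\<bar> \<bar>g w\<bar>\<close>.  The identity is transported from \<open>L\<^sup>1 \<inter> L\<^sup>2\<close> along an approximating sequence.
\<close>

lemma shift_difference_le:
  fixes f g :: "'a::euclidean_space \<Rightarrow> 'v"
  assumes f: "sq_integrable lebesgue f" and fg: "fourier_L2 f g"
    and s: "sq_integrable lebesgue (\<lambda>w. (s \<bullet> w) *\<^sub>R g w)"
  shows "sqrt ((2 * pi) ^ DIM('a)) * l2norm lebesgue (\<lambda>x. f (x + s) - f x)
    \<le> l2norm lebesgue (\<lambda>w. (s \<bullet> w) *\<^sub>R g w)"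
proof -
  have g: "sq_integrable lebesgue g" using fg by (simp add: fourier_L2_def)
  obtain h where h1: "\<And>k::nat. integrable lebesgue (h k)" and h2: "\<And>k. sq_integrable lebesgue (h k)"
    and hf: "(\<lambda>k. l2norm lebesgue (\<lambda>x. h k x - f x)) \<longlonglongrightarrow> 0"
    using ex_L1_L2_approximation[OF f] by blast
  have hg: "(\<lambda>k. l2norm lebesgue (\<lambda>w. fourier (h k) w - g w)) \<longlonglongrightarrow> 0"
    using fg h1 h2 hf by (auto simp: fourier_L2_def)
  define f' where "f' x = f (x + s) - f x" for x
  define h' where "h' k x = h k (x + s) - h k x" for k x
  define g' where "g' w = rot (- (s \<bullet> w)) (g w) - g w" for w
  have gm[measurable]: "g \<in> borel_measurable lebesgue" using g by (simp add: sq_integrable_def)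
  have g'm: "g' \<in> borel_measurable lebesgue" unfolding g'_def by measurable
  have T2: "norm (rot \<theta> v - v) \<le> 2 * norm v" for \<theta> v
    using norm_triangle_ineq4[of "rot \<theta> v" v] by (simp add: norm_rot)
  have f'2: "sq_integrable lebesgue f'"
    unfolding f'_def by (rule sq_integrable_diff[OF sq_integrable_shift(1)[OF f] f])
  have g'2: "sq_integrable lebesgue g'"
    by (rule sq_integrable_bound[OF g g'm, of 2]) (simp add: g'_def T2)
  have hs1: "integrable lebesgue (\<lambda>x. h k (x + s))" for k
    using integrable_lebesgue_shift[of "h k" s] h1[of k] by auto
  have h'1: "integrable lebesgue (h' k)" for k
    unfolding h'_def using hs1 h1 by auto
  have h'2: "sq_integrable lebesgue (h' k)" for k
    unfolding h'_def by (rule sq_integrable_diff[OF sq_integrable_shift(1)[OF h2] h2])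
  have lim_f: "(\<lambda>k. l2norm lebesgue (\<lambda>x. h' k x - f' x)) \<longlonglongrightarrow> 0"
  proof (rule Lim_null_comparison[OF always_eventually])
    show "(\<lambda>k. 2 * l2norm lebesgue (\<lambda>x. h k x - f x)) \<longlonglongrightarrow> 0"
      using tendsto_mult_right_zero[OF hf] by simp
    show "\<forall>k. norm (l2norm lebesgue (\<lambda>x. h' k x - f' x)) \<le> 2 * l2norm lebesgue (\<lambda>x. h k x - f x)"
    proof
      fix k
      have d: "sq_integrable lebesgue (\<lambda>x. h k x - f x)" by (rule sq_integrable_diff[OF h2 f])
      have "l2norm lebesgue (\<lambda>x. (h k (x + s) - f (x + s)) + (-1) *\<^sub>R (h k x - f x))
        \<le> l2norm lebesgue (\<lambda>x. h k (x + s) - f (x + s)) + l2norm lebesgue (\<lambda>x. (-1) *\<^sub>R (h k x - f x))"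
        by (intro l2norm_triangle sq_integrable_shift(1)[OF d] sq_integrable_scale d)
      also have "\<dots> = 2 * l2norm lebesgue (\<lambda>x. h k x - f x)"
        using sq_integrable_shift(2)[OF d, of s] l2norm_minus_commute[of lebesgue f "h k"] by simp
      finally show "norm (l2norm lebesgue (\<lambda>x. h' k x - f' x)) \<le> 2 * l2norm lebesgue (\<lambda>x. h k x - f x)"
        by (simp add: h'_def f'_def algebra_simps)
    qed
  qed
  have lim_g: "(\<lambda>k. l2norm lebesgue (\<lambda>w. fourier (h' k) w - g' w)) \<longlonglongrightarrow> 0"
  proof (rule Lim_null_comparison[OF always_eventually])
    show "(\<lambda>k. 2 * l2norm lebesgue (\<lambda>w. fourier (h k) w - g w)) \<longlonglongrightarrow> 0"
      using tendsto_mult_right_zero[OF hg] by simp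
    show "\<forall>k. norm (l2norm lebesgue (\<lambda>w. fourier (h' k) w - g' w)) \<le> 2 * l2norm lebesgue (\<lambda>w. fourier (h k) w - g w)"
    proof
      fix k
      have d: "sq_integrable lebesgue (\<lambda>w. fourier (h k) w - g w)"
        by (rule sq_integrable_diff[OF plancherel(1)[OF h1 h2] g])
      have "fourier (h' k) w - g' w
          = rot (- (s \<bullet> w)) (fourier (h k) w - g w) - (fourier (h k) w - g w)" for w
      proof -
        have "fourier (h' k) w = rot (- (s \<bullet> w)) (fourier (h k) w) - fourier (h k) w"
          unfolding h'_def[abs_def] by (simp only: fourier_diff[OF hs1 h1] fourier_shift[OF h1])
        then show ?thesis by (simp add: g'_def linear_diff[OF linear_rot])
      qed
      then have "norm (fourier (h' k) w - g' w) \<le> 2 * norm (fourier (h k) w - g w)" for w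
        using T2 by simp
      moreover have "(\<lambda>w. fourier (h' k) w - g' w) \<in> borel_measurable lebesgue"
        using plancherel(1)[OF h'1 h'2, of k] g'm
        by (intro borel_measurable_diff) (simp_all add: sq_integrable_def)
      ultimately have "l2norm lebesgue (\<lambda>w. fourier (h' k) w - g' w)
          \<le> 2 * l2norm lebesgue (\<lambda>w. fourier (h k) w - g w)"
        by (intro l2norm_mono[OF d]) auto
      then show "norm (l2norm lebesgue (\<lambda>w. fourier (h' k) w - g' w))
          \<le> 2 * l2norm lebesgue (\<lambda>w. fourier (h k) w - g w)" by simp
    qed
  qed
  have "sqrt ((2 * pi) ^ DIM('a)) * l2norm lebesgue f' = l2norm lebesgue g'"
    by (rule l2norm_fourier_limit[OF f'2 g'2 h'1 h'2 lim_f lim_g, symmetric])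
  also have "\<dots> \<le> 1 * l2norm lebesgue (\<lambda>w. (s \<bullet> w) *\<^sub>R g w)"
  proof (rule l2norm_mono[OF s g'm])
    show "norm (g' w) \<le> 1 * norm ((s \<bullet> w) *\<^sub>R g w)" for w
      using norm_rot_diff_le[of "- (s \<bullet> w)" "g w"] by (simp add: g'_def)
  qed simp
  finally show ?thesis by (simp add: f'_def[abs_def])
qed

text \<open>
  The inequality with finite differences of step \<open>t\<close>, before the limit \<open>t \<rightarrow> 0\<close>, is the fact \<open>main\<close>
  below; its error term \<open>t N\<close> appears because \<open>(e \<cdot> x) f(x + te)\<close> is the translate of
  \<open>(e \<cdot> x - t) f(x)\<close>.
\<close>

lemma directional_uncertainty:
  fixes f g :: "'a::euclidean_space \<Rightarrow> 'v"
  assumes f: "sq_integrable lebesgue f" and fg: "fourier_L2 f g" and e: "norm e = 1"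
    and xf: "sq_integrable lebesgue (\<lambda>x. (e \<bullet> x) *\<^sub>R f x)"
    and wg: "sq_integrable lebesgue (\<lambda>w. (e \<bullet> w) *\<^sub>R g w)"
  shows "(2 * pi) ^ DIM('a) * (l2norm lebesgue f) ^ 4
    \<le> 4 * (l2norm lebesgue (\<lambda>x. (e \<bullet> x) *\<^sub>R f x))\<^sup>2 * (l2norm lebesgue (\<lambda>w. (e \<bullet> w) *\<^sub>R g w))\<^sup>2"
proof -
  define c where "c = sqrt ((2 * pi) ^ DIM('a))"
  define N where "N = l2norm lebesgue f"
  define \<alpha> where "\<alpha> = l2norm lebesgue (\<lambda>x. (e \<bullet> x) *\<^sub>R f x)"
  define \<beta> where "\<beta> = l2norm lebesgue (\<lambda>w. (e \<bullet> w) *\<^sub>R g w)"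
  have nn: "0 \<le> c" "0 \<le> N" "0 \<le> \<alpha>" "0 \<le> \<beta>" by (auto simp: c_def N_def \<alpha>_def \<beta>_def)
  have main: "c * N\<^sup>2 \<le> \<beta> * (2 * \<alpha> + t * N)" if t: "0 < t" for t
  proof -
    define fs where "fs x = f (x + t *\<^sub>R e)" for x
    define \<phi> where "\<phi> x = (e \<bullet> x) *\<^sub>R f x - t *\<^sub>R f x" for x
    have tf: "sq_integrable lebesgue (\<lambda>x. t *\<^sub>R f x)" by (rule sq_integrable_scale[OF f])
    have \<phi>: "sq_integrable lebesgue \<phi>" unfolding \<phi>_def by (rule sq_integrable_diff[OF xf tf])
    have fs: "sq_integrable lebesgue fs" unfolding fs_def by (rule sq_integrable_shift(1)[OF f])
    have ee: "e \<bullet> e = 1" using e by (simp add: norm_eq_1)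
    have \<phi>s: "\<phi> (x + t *\<^sub>R e) = (e \<bullet> x) *\<^sub>R fs x" for x
      by (simp add: \<phi>_def fs_def inner_add_right ee algebra_simps)
    have xfs: "sq_integrable lebesgue (\<lambda>x. (e \<bullet> x) *\<^sub>R fs x)"
      using sq_integrable_shift(1)[OF \<phi>, of "t *\<^sub>R e"] by (simp only: \<phi>s)
    have "l2norm lebesgue (\<lambda>x. (e \<bullet> x) *\<^sub>R fs x) = l2norm lebesgue \<phi>"
      using sq_integrable_shift(2)[OF \<phi>, of "t *\<^sub>R e"] by (simp only: \<phi>s)
    also have "\<dots> \<le> \<alpha> + t * N"
    proof -
      have "l2norm lebesgue (\<lambda>x. (e \<bullet> x) *\<^sub>R f x + (- t) *\<^sub>R f x)
        \<le> \<alpha> + l2norm lebesgue (\<lambda>x. (- t) *\<^sub>R f x)"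
        unfolding \<alpha>_def by (rule l2norm_triangle[OF xf sq_integrable_scale[OF f]])
      also have "l2norm lebesgue (\<lambda>x. (- t) *\<^sub>R f x) \<le> t * N"
        unfolding N_def by (rule l2norm_mono[OF f]) (use t sq_integrable_scale[OF f, of "- t"] in \<open>auto simp: sq_integrable_def\<close>)
      finally show ?thesis by (simp add: \<phi>_def[abs_def])
    qed
    finally have le1: "l2norm lebesgue (\<lambda>x. (e \<bullet> x) *\<^sub>R fs x) \<le> \<alpha> + t * N" .
    let ?d = "\<lambda>x. fs x - f x" and ?u = "\<lambda>x. (e \<bullet> x) *\<^sub>R fs x + (e \<bullet> x) *\<^sub>R f x"
    have d: "sq_integrable lebesgue ?d" by (rule sq_integrable_diff[OF fs f])
    have u: "sq_integrable lebesgue ?u" by (rule sq_integrable_add[OF xfs xf])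
    have le2: "l2norm lebesgue ?u \<le> 2 * \<alpha> + t * N"
      using l2norm_triangle[OF xfs xf] le1 by (simp add: \<alpha>_def)
    have le3: "c * l2norm lebesgue ?d \<le> t * \<beta>"
    proof -
      have w: "sq_integrable lebesgue (\<lambda>w. ((t *\<^sub>R e) \<bullet> w) *\<^sub>R g w)"
        using sq_integrable_scale[OF wg, of t] by simp
      have "c * l2norm lebesgue ?d \<le> l2norm lebesgue (\<lambda>w. ((t *\<^sub>R e) \<bullet> w) *\<^sub>R g w)"
        unfolding c_def fs_def by (rule shift_difference_le[OF f fg w])
      also have "\<dots> \<le> t * \<beta>"
        unfolding \<beta>_def
        by (rule l2norm_mono[OF wg]) (use t w in \<open>auto simp: sq_integrable_def abs_mult\<close>)
      finally show ?thesis .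
    qed
    have bound: "(c * l2norm lebesgue ?d) * l2norm lebesgue ?u \<le> (t * \<beta>) * (2 * \<alpha> + t * N)"
      by (rule mult_mono[OF le3 le2]) (use t nn in auto)
    \<comment> \<open>Summation by parts: the integral of \<open>d \<cdot> u\<close> is the change of the first moment of \<open>\<bar>f\<bar>\<^sup>2\<close>
      under the translation.\<close>
    have i1: "integrable lebesgue (\<lambda>x. \<phi> x \<bullet> f x)" by (rule integrable_inner[OF \<phi> f])
    have i2: "integrable lebesgue (\<lambda>x. ((e \<bullet> x) *\<^sub>R f x) \<bullet> f x)" by (rule integrable_inner[OF xf f])
    have i3: "integrable lebesgue (\<lambda>x. ((e \<bullet> x) *\<^sub>R fs x) \<bullet> fs x)" by (rule integrable_inner[OF xfs fs])
    have i4: "integrable lebesgue (\<lambda>x. t * (norm (f x))\<^sup>2)" using f by (auto simp: sq_integrable_def)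
    have "(\<integral>x. ?d x \<bullet> ?u x \<partial>lebesgue)
        = (\<integral>x. ((e \<bullet> x) *\<^sub>R fs x) \<bullet> fs x - ((e \<bullet> x) *\<^sub>R f x) \<bullet> f x \<partial>lebesgue)"
      by (intro Bochner_Integration.integral_cong refl)
         (simp add: inner_diff_left inner_add_right inner_commute algebra_simps)
    also have "\<dots> = (\<integral>x. ((e \<bullet> x) *\<^sub>R fs x) \<bullet> fs x \<partial>lebesgue) - (\<integral>x. ((e \<bullet> x) *\<^sub>R f x) \<bullet> f x \<partial>lebesgue)"
      by (rule Bochner_Integration.integral_diff[OF i3 i2])
    also have "(\<integral>x. ((e \<bullet> x) *\<^sub>R fs x) \<bullet> fs x \<partial>lebesgue) = (\<integral>x. \<phi> x \<bullet> f x \<partial>lebesgue)"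
      using integral_lebesgue_shift[OF borel_measurable_integrable[OF i1], of "t *\<^sub>R e"]
      by (simp only: \<phi>s fs_def)
    also have "(\<integral>x. \<phi> x \<bullet> f x \<partial>lebesgue)
        = (\<integral>x. ((e \<bullet> x) *\<^sub>R f x) \<bullet> f x - t * (norm (f x))\<^sup>2 \<partial>lebesgue)"
      by (simp add: \<phi>_def inner_diff_left power2_norm_eq_inner)
    also have "\<dots> = (\<integral>x. ((e \<bullet> x) *\<^sub>R f x) \<bullet> f x \<partial>lebesgue) - t * N\<^sup>2"
      unfolding Bochner_Integration.integral_diff[OF i2 i4] by (simp add: N_def l2norm_power2)
    finally have "(\<integral>x. ?d x \<bullet> ?u x \<partial>lebesgue) = - (t * N\<^sup>2)" by simp
    then have "t * N\<^sup>2 \<le> l2norm lebesgue ?d * l2norm lebesgue ?u"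
      using abs_integral_inner_le[OF d u] t by simp
    then have "c * (t * N\<^sup>2) \<le> c * (l2norm lebesgue ?d * l2norm lebesgue ?u)"
      using nn by (intro mult_left_mono)
    also have "\<dots> \<le> (t * \<beta>) * (2 * \<alpha> + t * N)" using bound by (simp only: mult.assoc)
    finally have "t * (c * N\<^sup>2) \<le> t * (\<beta> * (2 * \<alpha> + t * N))" by (simp only: mult_ac)
    then show ?thesis using t by simp
  qed
  have "c * N\<^sup>2 \<le> 2 * \<alpha> * \<beta>"
  proof (rule field_le_epsilon)
    fix \<delta> :: real assume \<delta>: "0 < \<delta>"
    define t where "t = \<delta> / (\<beta> * N + 1)"
    have p: "0 < \<beta> * N + 1" using nn by (simp add: add_nonneg_pos)
    then have t: "0 < t" using \<delta> by (simp add: t_def)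
    have "t * (\<beta> * N) \<le> t * (\<beta> * N + 1)" using t by (intro mult_left_mono) auto
    also have "\<dots> = \<delta>" using p by (simp add: t_def)
    finally show "c * N\<^sup>2 \<le> 2 * \<alpha> * \<beta> + \<delta>"
      using main[OF t] by (simp add: algebra_simps)
  qed
  then have "(c * N\<^sup>2)\<^sup>2 \<le> (2 * \<alpha> * \<beta>)\<^sup>2"
    using nn by (intro power_mono) auto
  moreover have "c\<^sup>2 = (2 * pi) ^ DIM('a)" by (simp add: c_def)
  ultimately show ?thesis
    by (simp add: power_mult_distrib N_def \<alpha>_def \<beta>_def flip: power_mult)
qed

lemma nn_integral_weighted_eq_sum:
  fixes f :: "'a::euclidean_space \<Rightarrow> 'v"
  assumes f: "f \<in> borel_measurable lebesgue"
    and fin: "(\<integral>\<^sup>+x. ennreal ((norm x)\<^sup>2 * (norm (f x))\<^sup>2) \<partial>lebesgue) \<noteq> \<infinity>"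
  shows "b \<in> Basis \<Longrightarrow> sq_integrable lebesgue (\<lambda>x. (b \<bullet> x) *\<^sub>R f x)"
    and "(\<integral>\<^sup>+x. ennreal ((norm x)\<^sup>2 * (norm (f x))\<^sup>2) \<partial>lebesgue)
      = ennreal (\<Sum>b\<in>Basis. (l2norm lebesgue (\<lambda>x. (b \<bullet> x) *\<^sub>R f x))\<^sup>2)"
proof -
  note [measurable] = f
  have nm: "(\<lambda>x::'a. norm x) \<in> borel_measurable lebesgue" by (intro measurable_completion) simp
  note [measurable] = nm
  have i: "integrable lebesgue (\<lambda>x. (norm x)\<^sup>2 * (norm (f x))\<^sup>2)"
    using fin by (intro integrableI_nonneg) (auto simp: less_top)
  have sum: "(norm x)\<^sup>2 * (norm (f x))\<^sup>2 = (\<Sum>b\<in>Basis. (norm ((b \<bullet> x) *\<^sub>R f x))\<^sup>2)" for x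
  proof -
    have "(norm x)\<^sup>2 = (\<Sum>b\<in>Basis. (b \<bullet> x)\<^sup>2)"
      unfolding power2_norm_eq_inner by (subst euclidean_inner) (simp add: power2_eq_square inner_commute)
    then show ?thesis by (simp add: sum_distrib_right power_mult_distrib)
  qed
  have sq: "sq_integrable lebesgue (\<lambda>x. (b \<bullet> x) *\<^sub>R f x)" if "b \<in> Basis" for b
  proof -
    have le: "norm ((norm ((b \<bullet> x) *\<^sub>R f x))\<^sup>2) \<le> norm ((norm x)\<^sup>2 * (norm (f x))\<^sup>2)" for x
      unfolding sum using that
      by (simp add: member_le_sum[of b Basis "\<lambda>b. (norm ((b \<bullet> x) *\<^sub>R f x))\<^sup>2"] sum_nonneg del: norm_scaleR)
    have "(\<lambda>x. (b \<bullet> x) *\<^sub>R f x) \<in> borel_measurable lebesgue" by measurable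
    moreover have "integrable lebesgue (\<lambda>x. (norm ((b \<bullet> x) *\<^sub>R f x))\<^sup>2)"
      by (rule Bochner_Integration.integrable_bound[OF i _ AE_I2[OF le]]) measurable
    ultimately show ?thesis by (simp add: sq_integrable_def)
  qed
  then show "b \<in> Basis \<Longrightarrow> sq_integrable lebesgue (\<lambda>x. (b \<bullet> x) *\<^sub>R f x)" .
  have "(\<integral>\<^sup>+x. ennreal ((norm x)\<^sup>2 * (norm (f x))\<^sup>2) \<partial>lebesgue)
      = ennreal (\<integral>x. (norm x)\<^sup>2 * (norm (f x))\<^sup>2 \<partial>lebesgue)"
    by (rule nn_integral_eq_integral[OF i]) simp
  also have "(\<integral>x. (norm x)\<^sup>2 * (norm (f x))\<^sup>2 \<partial>lebesgue)
      = (\<Sum>b\<in>Basis. (l2norm lebesgue (\<lambda>x. (b \<bullet> x) *\<^sub>R f x))\<^sup>2)"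
    unfolding sum l2norm_power2 using sq by (intro Bochner_Integration.integral_sum) (simp add: sq_integrable_def)
  finally show "(\<integral>\<^sup>+x. ennreal ((norm x)\<^sup>2 * (norm (f x))\<^sup>2) \<partial>lebesgue)
      = ennreal (\<Sum>b\<in>Basis. (l2norm lebesgue (\<lambda>x. (b \<bullet> x) *\<^sub>R f x))\<^sup>2)" .
qed

lemma nn_integral_weighted_eq_0_imp:
  fixes f :: "'a::euclidean_space \<Rightarrow> 'v"
  assumes f: "f \<in> borel_measurable lebesgue"
    and z: "(\<integral>\<^sup>+x. ennreal ((norm x)\<^sup>2 * (norm (f x))\<^sup>2) \<partial>lebesgue) = 0"
  shows "l2norm lebesgue f = 0"
proof -
  note [measurable] = f
  have nm: "(\<lambda>x::'a. norm x) \<in> borel_measurable lebesgue" by (intro measurable_completion) simp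
  note [measurable] = nm
  have "AE x in lebesgue. ennreal ((norm x)\<^sup>2 * (norm (f x))\<^sup>2) = 0"
    using z by (subst (asm) nn_integral_0_iff_AE) auto
  moreover have "AE x in lebesgue. x \<noteq> (0::'a)"
    using AE_lborel_singleton by (rule AE_completion)
  ultimately have "AE x in lebesgue. f x = 0"
    by eventually_elim simp
  then have "AE x in lebesgue. (norm (f x))\<^sup>2 = 0" by eventually_elim simp
  from integral_eq_zero_AE[OF this] show ?thesis by (simp add: l2norm_def)
qed

text \<open>
  If both integrals are finite, they are sums \<open>\<Sum>\<^sub>b A\<^sub>b\<close> and \<open>\<Sum>\<^sub>b B\<^sub>b\<close> of directional moments over an
  orthonormal basis, and their product is at least \<open>\<Sum>\<^sub>b A\<^sub>b B\<^sub>b\<close>.  If one of them is infinite, the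
  convention \<open>0 \<cdot> \<infinity> = 0\<close> could only do harm when the other vanishes; but then \<open>f\<close> or \<open>g\<close> is zero almost
  everywhere, and by Plancherel's identity \<open>f\<close> has norm \<open>0\<close>.
\<close>

theorem heisenberg_uncertainty:
  fixes f g :: "'a::euclidean_space \<Rightarrow> 'v"
  assumes f: "sq_integrable lebesgue f" and fg: "fourier_L2 f g"
  shows "(\<integral>\<^sup>+x. ennreal ((norm x)\<^sup>2 * (norm (f x))\<^sup>2) \<partial>lebesgue)
      * (ennreal (1 / (2 * pi) ^ DIM('a)) * (\<integral>\<^sup>+w. ennreal ((norm w)\<^sup>2 * (norm (g w))\<^sup>2) \<partial>lebesgue))
    \<ge> ennreal (real DIM('a) * (1 / 4) * (l2norm lebesgue f) ^ 4)"
proof -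
  let ?X = "\<integral>\<^sup>+x. ennreal ((norm x)\<^sup>2 * (norm (f x))\<^sup>2) \<partial>lebesgue"
  let ?Y = "\<integral>\<^sup>+w. ennreal ((norm w)\<^sup>2 * (norm (g w))\<^sup>2) \<partial>lebesgue"
  define C where "C = (2 * pi) ^ DIM('a)"
  have C: "0 < C" by (simp add: C_def)
  have g: "sq_integrable lebesgue g" using fg by (simp add: fourier_L2_def)
  have fm: "f \<in> borel_measurable lebesgue" and gm: "g \<in> borel_measurable lebesgue"
    using f g by (auto simp: sq_integrable_def)
  obtain h where h1: "\<And>k::nat. integrable lebesgue (h k)" and h2: "\<And>k. sq_integrable lebesgue (h k)"
    and hf: "(\<lambda>k. l2norm lebesgue (\<lambda>x. h k x - f x)) \<longlonglongrightarrow> 0"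
    using ex_L1_L2_approximation[OF f] by blast
  have hg: "(\<lambda>k. l2norm lebesgue (\<lambda>w. fourier (h k) w - g w)) \<longlonglongrightarrow> 0"
    using fg h1 h2 hf by (auto simp: fourier_L2_def)
  have fg_norm: "l2norm lebesgue g = sqrt C * l2norm lebesgue f"
    unfolding C_def by (rule l2norm_fourier_limit[OF f g h1 h2 hf hg])
  consider "l2norm lebesgue f = 0" | "l2norm lebesgue f \<noteq> 0" "?X = \<infinity> \<or> ?Y = \<infinity>"
    | "?X \<noteq> \<infinity>" "?Y \<noteq> \<infinity>" by blast
  then show ?thesis
  proof cases
    case 1
    then show ?thesis by simp
  next
    case 2
    have "?X \<noteq> 0" using nn_integral_weighted_eq_0_imp[OF fm] 2(1) by blast
    moreover have "?Y \<noteq> 0"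
      using nn_integral_weighted_eq_0_imp[OF gm] 2(1) fg_norm C by auto
    moreover have "ennreal (1 / C) \<noteq> 0" using C by simp
    ultimately have "?X * (ennreal (1 / C) * ?Y) = \<infinity>"
      using 2(2) by (auto simp: ennreal_mult_eq_top_iff)
    then show ?thesis by (simp add: C_def)
  next
    case 3
    define A where "A b = (l2norm lebesgue (\<lambda>x. (b \<bullet> x) *\<^sub>R f x))\<^sup>2" for b
    define B where "B b = (l2norm lebesgue (\<lambda>w. (b \<bullet> w) *\<^sub>R g w))\<^sup>2" for b
    note fX = nn_integral_weighted_eq_sum[OF fm 3(1)] and gY = nn_integral_weighted_eq_sum[OF gm 3(2)]
    have AB: "C * (l2norm lebesgue f) ^ 4 \<le> 4 * A b * B b" if b: "b \<in> Basis" for b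
      unfolding A_def B_def C_def
      by (rule directional_uncertainty[OF f fg norm_Basis[OF b] fX(1)[OF b] gY(1)[OF b]])
    have "real DIM('a) * (C * (l2norm lebesgue f) ^ 4) = (\<Sum>b\<in>(Basis::'a set). C * (l2norm lebesgue f) ^ 4)"
      by simp
    also have "\<dots> \<le> (\<Sum>b\<in>Basis. 4 * (A b * B b))"
      by (rule sum_mono) (use AB in \<open>simp add: mult.assoc\<close>)
    also have "\<dots> = 4 * (\<Sum>b\<in>Basis. A b * B b)" by (simp add: sum_distrib_left)
    also have "(\<Sum>b\<in>Basis. A b * B b) \<le> (\<Sum>b\<in>Basis. A b * (\<Sum>c\<in>Basis. B c))"
      by (intro sum_mono mult_left_mono member_le_sum) (auto simp: A_def B_def)
    finally have le: "real DIM('a) * (C * (l2norm lebesgue f) ^ 4) \<le> 4 * ((\<Sum>b\<in>Basis. A b) * (\<Sum>b\<in>Basis. B b))"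
      by (simp add: sum_distrib_right)
    have nnA: "0 \<le> (\<Sum>b\<in>Basis. A b)" and nnB: "0 \<le> (\<Sum>b\<in>Basis. B b)"
      by (auto intro!: sum_nonneg simp: A_def B_def)
    have "real DIM('a) * (1 / 4) * (l2norm lebesgue f) ^ 4
        \<le> (\<Sum>b\<in>Basis. A b) * (1 / C * (\<Sum>b\<in>Basis. B b))"
      using le C by (simp add: field_simps)
    then have "ennreal (real DIM('a) * (1 / 4) * (l2norm lebesgue f) ^ 4)
        \<le> ennreal ((\<Sum>b\<in>Basis. A b) * (1 / C * (\<Sum>b\<in>Basis. B b)))"
      by (rule ennreal_leI)
    also have "\<dots> = ?X * (ennreal (1 / C) * ?Y)"
      unfolding fX(2) gY(2) A_def[symmetric] B_def[symmetric]
      using nnA nnB C by (simp only: ennreal_mult mult_nonneg_nonneg divide_nonneg_pos zero_le_one)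
    finally show ?thesis unfolding C_def .
  qed
qed

end

section \<open>The Clifford algebra as a Euclidean space with a complex structure\<close>

lemma principal_reverse_blade: "principal_reverse p (blade A) = blade_sign p A A *\<^sub>R blade A"
  by (simp add: vec_eq_iff principal_reverse_nth blade_sign_self blade_nth)

lemma linear_principal_reverse: "linear (principal_reverse p)"
  by (rule linearI) (simp_all add: vec_eq_iff principal_reverse_nth algebra_simps)

lemma blade_sign_square: "blade_sign p A B * blade_sign p A B = 1"
  unfolding blade_sign_def by (auto simp: prod.distrib [symmetric] intro!: prod.neutral)

text \<open>
  On blades, \<open>rev e\<^sub>A = \<sigma>(A,A) e\<^sub>A\<close> where \<open>\<sigma>\<close> is \<^const>\<open>blade_sign\<close>.  As \<open>\<sigma>\<close> is multiplicative in each
  argument with respect to symmetric differences, \<open>\<sigma>(A \<Delta> B, A \<Delta> B)\<close> is the product of \<open>\<sigma>(A,A)\<close>,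
  \<open>\<sigma>(A,B)\<close>, \<open>\<sigma>(B,A)\<close> and \<open>\<sigma>(B,B)\<close>.
\<close>

lemma principal_reverse_gprod:
  "principal_reverse p (gprod p M N) = gprod p (principal_reverse p N) (principal_reverse p M)"
proof -
  have blades: "principal_reverse p (gprod p (blade A) (blade B))
      = gprod p (principal_reverse p (blade B)) (principal_reverse p (blade A))" for A B :: "'a set"
  proof -
    have c: "sym_diff B A = sym_diff A B" by blast
    have "blade_sign p A B * blade_sign p (sym_diff A B) (sym_diff A B)
        = blade_sign p A A * blade_sign p B B * blade_sign p B A * (blade_sign p A B * blade_sign p A B)"
      by (simp only: blade_sign_left blade_sign_right mult_ac)
    then show ?thesis
      by (simp add: gprod_blade gprod_scaleR principal_reverse_blade linear_scale[OF linear_principal_reverse]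
          c blade_sign_square mult_ac)
  qed
  show ?thesis
    by (subst (1 2) multivector_expansion[of M], subst (1 2) multivector_expansion[of N])
       (simp only: gprod_sum_left gprod_sum_right gprod_scaleR linear_sum[OF linear_principal_reverse]
          linear_scale[OF linear_principal_reverse] blades scaleR_scaleR scaleR_sum_right mult.commute,
        rule sum.swap)
qed

text \<open>
  Moving \<open>i\<close> from one factor of \<open>M \<ast> rev N\<close> to the other turns it into \<open>rev i = - i\<close>.
\<close>

lemma right_multiplication_skew:
  assumes "principal_reverse p i = - i"
  shows "gprod p M i \<bullet> N = - (M \<bullet> gprod p N i)"
proof -
  have "gprod p M i \<bullet> N = scalar_prod p (gprod p M i) (principal_reverse p N)"
    by (simp add: scalar_prod_principal_reverse)
  also have "\<dots> = - scalar_prod p M (gprod p (principal_reverse p i) (principal_reverse p N))"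
    by (simp add: assms scalar_prod_def gprod_assoc bilinear_lneg[OF bilinear_gprod]
        bilinear_rneg[OF bilinear_gprod])
  also have "\<dots> = - (M \<bullet> gprod p N i)"
    by (simp only: principal_reverse_gprod[symmetric] scalar_prod_principal_reverse)
  finally show ?thesis .
qed

lemma complex_structure_gprod:
  assumes i_square: "gprod p i i = - blade {}" and i_reverse: "principal_reverse p i = - i"
  shows "orthogonal_complex_structure (\<lambda>M. gprod p M i)"
proof (rule orthogonal_complex_structure.intro)
  show "linear (\<lambda>M. gprod p M i)" using bilinear_gprod unfolding bilinear_def by blast
  show "gprod p (gprod p v i) i = - v" for v
    by (simp add: gprod_assoc i_square bilinear_rneg[OF bilinear_gprod] gprod_one)
  show "gprod p u i \<bullet> v = - (u \<bullet> gprod p v i)" for u v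
    by (rule right_multiplication_skew[OF i_reverse])
qed

lemma L2_space_iff: "f \<in> L2_space \<longleftrightarrow> sq_integrable lebesgue f"
  by (simp add: L2_space_def sq_integrable_def)

lemma L2_tendsto_iff:
  assumes "\<And>k. sq_integrable lebesgue (h k)" "sq_integrable lebesgue f"
  shows "L2_tendsto h f \<longleftrightarrow> (\<lambda>k. l2norm lebesgue (\<lambda>x. h k x - f x)) \<longlonglongrightarrow> 0"
proof -
  have "L2_tendsto h f \<longleftrightarrow> (\<lambda>k. ennreal ((l2norm lebesgue (\<lambda>x. h k x - f x))\<^sup>2)) \<longlonglongrightarrow> ennreal 0"
    unfolding L2_tendsto_def by (simp add: nn_integral_norm_power2[OF sq_integrable_diff[OF assms]])
  also have "\<dots> \<longleftrightarrow> (\<lambda>k. (l2norm lebesgue (\<lambda>x. h k x - f x))\<^sup>2) \<longlonglongrightarrow> 0"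
    by (rule tendsto_ennreal_iff) auto
  also have "\<dots> \<longleftrightarrow> (\<lambda>k. l2norm lebesgue (\<lambda>x. h k x - f x)) \<longlonglongrightarrow> 0"
  proof
    assume "(\<lambda>k. (l2norm lebesgue (\<lambda>x. h k x - f x))\<^sup>2) \<longlonglongrightarrow> 0"
    from tendsto_real_sqrt[OF this] show "(\<lambda>k. l2norm lebesgue (\<lambda>x. h k x - f x)) \<longlonglongrightarrow> 0" by simp
  next
    assume "(\<lambda>k. l2norm lebesgue (\<lambda>x. h k x - f x)) \<longlonglongrightarrow> 0"
    from tendsto_power[OF this, of 2] show "(\<lambda>k. (l2norm lebesgue (\<lambda>x. h k x - f x))\<^sup>2) \<longlonglongrightarrow> 0" by simp
  qed
  finally show ?thesis .
qed

theorem theorem4p4: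
  fixes p q :: nat
    and i :: "'n::{finite,linorder} multivector"
    and f :: "'n coords \<Rightarrow> 'n multivector"
    and F :: real
  assumes dim: "CARD('n) = p + q"
    and i_square: "gprod p i i = - blade {}"
    and i_reverse: "principal_reverse p i = - i"
    and f_L2: "f \<in> L2_space"
    and F_eq: "F = (\<integral>x. (norm (f x))\<^sup>2 \<partial>lebesgue)"
  shows "(\<integral>\<^sup>+x. ennreal ((norm x)\<^sup>2 * (norm (f x))\<^sup>2) \<partial>lebesgue)
         * (ennreal (1 / (2 * pi) ^ (p + q))
            * (\<integral>\<^sup>+w. ennreal ((norm w)\<^sup>2 * (norm (CFT p i f w))\<^sup>2) \<partial>lebesgue))
         \<ge> ennreal (real (p + q) * (1 / 4) * F\<^sup>2)"
proof -
  interpret orthogonal_complex_structure "\<lambda>M. gprod p M i"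
    by (rule complex_structure_gprod[OF i_square i_reverse])
  have f: "sq_integrable lebesgue f" using f_L2 by (simp add: L2_space_iff)
  have CFT1: "CFT_L1 p i h = fourier h" for h :: "'n coords \<Rightarrow> 'n multivector"
    by (rule ext)
       (simp add: CFT_L1_def fourier_def rot_def exp_neg_def phase_eq_inner gprod_scaleR gprod_one
          bilinear_rsub[OF bilinear_gprod])
  have iff: "is_CFT_L2 p i f g \<longleftrightarrow> fourier_L2 f g" for g
  proof (cases "sq_integrable lebesgue g")
    case True
    have "L2_tendsto h f \<longleftrightarrow> (\<lambda>k. l2norm lebesgue (\<lambda>x. h k x - f x)) \<longlonglongrightarrow> 0"
      "L2_tendsto (\<lambda>k. fourier (h k)) g \<longleftrightarrow> (\<lambda>k. l2norm lebesgue (\<lambda>w. fourier (h k) w - g w)) \<longlonglongrightarrow> 0"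
      if "\<forall>k. integrable lebesgue (h k) \<and> sq_integrable lebesgue (h k)" for h
      using that f True by (auto intro!: L2_tendsto_iff plancherel(1))
    then show ?thesis
      using True unfolding is_CFT_L2_def fourier_L2_def
      by (auto simp: L2_space_iff L1_space_def CFT1)
  qed (simp add: is_CFT_L2_def fourier_L2_def L2_space_iff)
  have "\<exists>g. is_CFT_L2 p i f g" using ex_fourier_L2[OF f] by (simp only: iff)
  then have "is_CFT_L2 p i f (CFT p i f)"
    unfolding CFT_def by (rule someI_ex)
  then have "fourier_L2 f (CFT p i f)" by (simp add: iff)
  note H = heisenberg_uncertainty[OF f this]
  have "(l2norm lebesgue f) ^ 4 = ((l2norm lebesgue f)\<^sup>2)\<^sup>2"
    unfolding power_mult[symmetric] by simp
  also have "\<dots> = F\<^sup>2" by (simp only: F_eq l2norm_power2)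
  finally have F4: "(l2norm lebesgue f) ^ 4 = F\<^sup>2" .
  have "DIM('n coords) = p + q" using dim by simp
  then show ?thesis using H unfolding F4 by (simp only:)
qed

end
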